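(* For any fixed finite poset $P$ that is neither a chain nor an antichain, as $n\to\infty$, $$\mathrm{ar}^*_m(n,2^n,P)=\frac{(1-o(1))2^n}{\alpha(G_P^*[\mathcal M_n])}.$$ Furthermore, $\alpha(G_P^*[\mathcal M_n])$ can take any positive integer as its value: for every positive integer $t$ there is a finite poset $P$, neither a chain nor an antichain, such that $\alpha(G_P^*[\mathcal M_n])=t$ for all sufficiently large $n$.
   Context: $[n]=\{1,\dots,n\}$. A family $\mathcal G$ of sets is a strong copy of a poset $(P,\preceq)$ if there is a bijection $\iota:P\to\mathcal G$ such that $p\preceq q$ if and only if $\iota(p)\subseteq\iota(q)$. A copy is rainbow under a coloring if all its sets receive distinct colors. For $1<m\le 2^n$, $\mathrm{ar}^*_m(n,m,P)$ is the minimum integer $k$ such that there exist $\mathcal F\subseteq 2^{[n]}$ with $|\mathcal F|=m$ and a coloring $\mathcal F\to[k]$ under which every strong copy of $P$ contained in $\mathcal F$ is rainbow. $\mathcal M_n=\{F\subseteq[n]: \big||F|-n/2\big|\le n^{2/3}\}$. $G_P^*(n)$ is the graph with vertex set $2^{[n]}$ in which two distinct sets $F,G$ are adjacent if and only if some strong copy of $P$ in $2^{[n]}$ contains both $F$ and $G$; $G_P^*[\mathcal M_n]$ is its subgraph induced on $\mathcal M_n$. $\alpha$ denotes the independence number. *)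

theory Defs
  imports Complex_Main "HOL-Library.Landau_Symbols"
begin

(* A finite poset is a carrier P with a reflexive order relation r on it;
   (p, q) : r stands for p \<preceq> q. *)

definition finite_poset :: "'a set \<Rightarrow> 'a rel \<Rightarrow> bool" where
  "finite_poset P r \<longleftrightarrow> finite P \<and> partial_order_on P r"

definition poset_chain :: "'a set \<Rightarrow> 'a rel \<Rightarrow> bool" where
  "poset_chain P r \<longleftrightarrow> (\<forall>p\<in>P. \<forall>q\<in>P. (p, q) \<in> r \<or> (q, p) \<in> r)"

definition poset_antichain :: "'a set \<Rightarrow> 'a rel \<Rightarrow> bool" where
  "poset_antichain P r \<longleftrightarrow> (\<forall>p\<in>P. \<forall>q\<in>P. (p, q) \<in> r \<longrightarrow> p = q)"

definition strong_copy :: "'a set \<Rightarrow> 'a rel \<Rightarrow> nat set set \<Rightarrow> bool" where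
  "strong_copy P r \<G> \<longleftrightarrow>
     (\<exists>\<iota>. bij_betw \<iota> P \<G> \<and> (\<forall>p\<in>P. \<forall>q\<in>P. (p, q) \<in> r \<longleftrightarrow> \<iota> p \<subseteq> \<iota> q))"

definition rainbow :: "(nat set \<Rightarrow> nat) \<Rightarrow> nat set set \<Rightarrow> bool" where
  "rainbow c \<G> \<longleftrightarrow> inj_on c \<G>"

(* Only meaningful for 1 < m \<le> 2 ^ n; the set of admissible k is then nonempty
   (an injective coloring with k = m works). *)
definition ar_star_m :: "nat \<Rightarrow> nat \<Rightarrow> 'a set \<Rightarrow> 'a rel \<Rightarrow> nat" where
  "ar_star_m n m P r =
     (LEAST k. \<exists>\<F> c. \<F> \<subseteq> Pow {1..n} \<and> card \<F> = m \<and> c ` \<F> \<subseteq> {1..k} \<and>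
        (\<forall>\<G>. \<G> \<subseteq> \<F> \<and> strong_copy P r \<G> \<longrightarrow> rainbow c \<G>))"

definition middle :: "nat \<Rightarrow> nat set set" where
  "middle n = {F. F \<subseteq> {1..n} \<and> \<bar>real (card F) - real n / 2\<bar> \<le> real n powr (2 / 3)}"

(* Simple graphs as (vertex set, set of two-element edges). *)
type_synonym 'v graph = "'v set \<times> 'v set set"

definition induced :: "'v graph \<Rightarrow> 'v set \<Rightarrow> 'v graph" where
  "induced G U = (fst G \<inter> U, {e \<in> snd G. e \<subseteq> U})"

definition independent_in :: "'v graph \<Rightarrow> 'v set \<Rightarrow> bool" where
  "independent_in G I \<longleftrightarrow> I \<subseteq> fst G \<and> (\<forall>u\<in>I. \<forall>v\<in>I. {u, v} \<notin> snd G)"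

(* For graphs with finitely many vertices. *)
definition independence_number :: "'v graph \<Rightarrow> nat" where
  "independence_number G = Max (card ` {I. independent_in G I})"

definition copy_graph :: "'a set \<Rightarrow> 'a rel \<Rightarrow> nat \<Rightarrow> nat set graph" where
  "copy_graph P r n =
     (Pow {1..n},
      {{F, G} | F G. F \<noteq> G \<and> (\<exists>\<G> \<subseteq> Pow {1..n}. strong_copy P r \<G> \<and> F \<in> \<G> \<and> G \<in> \<G>)})"

end

theory Submission
  imports Defs
begin

text \<open>
  A family of \<open>2 ^ n\<close> subsets of \<open>{1..n}\<close> is the whole power set, so \<open>ar_star_m n (2 ^ n) P r\<close> is the
  chromatic number of the copy graph. Each colour class meets the middle layers, which contain almost all sets,
  in an independent set. With \<open>\<alpha>\<close> for the independence number this gives the lower bound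
  \<open>(1 - o(1)) * 2 ^ n / \<alpha>\<close>. For the upper bound almost all of the cube has to be partitioned into
  independent sets of size \<open>\<alpha>\<close>, and this requires knowing what large independent sets look like.

  An embedding of the poset amounts to the choice of an up-set of the poset, its profile, for every ground element.
  There are finitely many up-sets, so whether \<open>F\<close> and \<open>G\<close> are adjacent depends only on the sizes of the
  four cells of their Venn diagram, truncated at a constant (\<open>joint_copy_transfer\<close>). Counting principal
  up-sets shows that nested sets of the middle layers with a large difference are adjacent, because the
  poset is not an antichain (\<open>joint_copy_comparable\<close>), and that incomparable sets are adjacent unless their
  intersection or the complement of their union is small, because the poset is not a chain
  (\<open>joint_copy_incomparable\<close>). Hence an independent set of the middle layers is a short chain together
  with a second short chain of sets almost complementary to the first. Only the sizes matter, so they may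
  be filled in to two blocks of \<open>c1\<close> and \<open>c2\<close> consecutive sizes with \<open>c1 + c2 \<ge> \<alpha>\<close>, and these blocks can be
  moved to any other place and to any other chain (\<open>exists_window_shape\<close>).

  The power set of \<open>{1..n - 1}\<close> has a decomposition into \<open>o(2 ^ n)\<close> saturated chains, and the complements in
  \<open>{1..n}\<close> of the members of these chains are exactly the sets that contain \<open>n\<close>. Each chain and its chain of complements are
  cut into alternating blocks of \<open>c1\<close> and \<open>c2\<close> sets, so that a block of one size on the first chain is
  matched with a block of the other size on the second. This wastes only boundedly many colours per chain
  (\<open>card_window_colours_le\<close>).

  The standard example on \<open>2 * (t + 2)\<close> elements has independence number \<open>t\<close>: incomparable sets of the middle
  layers are always adjacent, and each relation forces a difference of at least \<open>t\<close>, because the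
  remaining \<open>t\<close> critical pairs need distinct witnesses inside it.
\<close>

section \<open>Joint copies and profiles\<close>

text \<open>The adjacency relation of the copy graph (up to the exclusion of loops), over an arbitrary
  ground set so that it can be transported along maps of ground sets.\<close>
definition joint_copy :: "'a set \<Rightarrow> 'a rel \<Rightarrow> nat set \<Rightarrow> nat set \<Rightarrow> nat set \<Rightarrow> bool" where
  "joint_copy P r X F G \<longleftrightarrow>
     (\<exists>\<iota>. (\<forall>p\<in>P. \<iota> p \<subseteq> X) \<and> (\<forall>p\<in>P. \<forall>q\<in>P. (p, q) \<in> r \<longleftrightarrow> \<iota> p \<subseteq> \<iota> q) \<and>
          F \<in> \<iota> ` P \<and> G \<in> \<iota> ` P)"

lemma finite_posetD:
  assumes "finite_poset P r"
  shows "finite P" "\<And>x. x \<in> P \<Longrightarrow> (x, x) \<in> r"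
    "\<And>x y. (x, y) \<in> r \<Longrightarrow> (y, x) \<in> r \<Longrightarrow> x = y"
    "\<And>x y z. (x, y) \<in> r \<Longrightarrow> (y, z) \<in> r \<Longrightarrow> (x, z) \<in> r"
  using assms unfolding finite_poset_def partial_order_on_def preorder_on_def
  by (auto dest: refl_onD antisymD transD)

lemma joint_copy_sym: "joint_copy P r X F G \<longleftrightarrow> joint_copy P r X G F"
  unfolding joint_copy_def by blast

lemma joint_copy_iff_strong_copy:
  assumes "finite_poset P r"
  shows "joint_copy P r X F G \<longleftrightarrow> (\<exists>\<G>\<subseteq>Pow X. strong_copy P r \<G> \<and> F \<in> \<G> \<and> G \<in> \<G>)"
proof
  assume "joint_copy P r X F G"
  then obtain \<iota> where i: "\<forall>p\<in>P. \<iota> p \<subseteq> X" "\<forall>p\<in>P. \<forall>q\<in>P. (p, q) \<in> r \<longleftrightarrow> \<iota> p \<subseteq> \<iota> q"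
    "F \<in> \<iota> ` P" "G \<in> \<iota> ` P" unfolding joint_copy_def by blast
  have "inj_on \<iota> P"
  proof (rule inj_onI)
    fix x y assume "x \<in> P" "y \<in> P" "\<iota> x = \<iota> y"
    with i(2) have "(x, y) \<in> r" "(y, x) \<in> r" by auto
    then show "x = y" using finite_posetD(3)[OF assms] by blast
  qed
  then have "strong_copy P r (\<iota> ` P)"
    unfolding strong_copy_def using i(2) inj_on_imp_bij_betw by blast
  with i show "\<exists>\<G>\<subseteq>Pow X. strong_copy P r \<G> \<and> F \<in> \<G> \<and> G \<in> \<G>" by blast
next
  assume "\<exists>\<G>\<subseteq>Pow X. strong_copy P r \<G> \<and> F \<in> \<G> \<and> G \<in> \<G>"
  then obtain \<G> \<iota> where g: "\<G> \<subseteq> Pow X" "F \<in> \<G>" "G \<in> \<G>" "bij_betw \<iota> P \<G>"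
    "\<forall>p\<in>P. \<forall>q\<in>P. (p, q) \<in> r \<longleftrightarrow> \<iota> p \<subseteq> \<iota> q" unfolding strong_copy_def by blast
  have "\<iota> ` P = \<G>" using g(4) by (simp add: bij_betw_def)
  with g show "joint_copy P r X F G" unfolding joint_copy_def by blast
qed

text \<open>The cells of the Venn diagram of \<open>F\<close> and \<open>G\<close> in \<open>X\<close>, indexed by the truth values of
  membership in \<open>F\<close> and in \<open>G\<close>; this lets the four cells be treated uniformly.\<close>
definition cell :: "nat set \<Rightarrow> nat set \<Rightarrow> nat set \<Rightarrow> bool \<Rightarrow> bool \<Rightarrow> nat set" where
  "cell X F G b c = {e \<in> X. (e \<in> F \<longleftrightarrow> b) \<and> (e \<in> G \<longleftrightarrow> c)}"

text \<open>For an embedding \<open>\<iota>\<close> of the poset into a power set, the profile of a ground element \<open>e\<close> is the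
  set of all \<open>p\<close> with \<open>e \<in> \<iota> p\<close>. Profiles are up-sets, and if \<open>\<iota> u = F\<close> and \<open>\<iota> v = G\<close>, then the cell
  that contains \<open>e\<close> records which of \<open>u\<close> and \<open>v\<close> lie in the profile.\<close>
definition profiles :: "'a set \<Rightarrow> 'a rel \<Rightarrow> 'a \<Rightarrow> 'a \<Rightarrow> bool \<Rightarrow> bool \<Rightarrow> 'a set set" where
  "profiles P r u v b c =
     {U. U \<subseteq> P \<and> (\<forall>x\<in>U. \<forall>y\<in>P. (x, y) \<in> r \<longrightarrow> y \<in> U) \<and> (u \<in> U \<longleftrightarrow> b) \<and> (v \<in> U \<longleftrightarrow> c)}"

lemma exists_cover_into:
  assumes "finite A" "finite B" "A \<subseteq> S" "card A \<le> card B" "B \<noteq> {} \<Longrightarrow> S \<noteq> {}"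
  shows "\<exists>f. f ` B \<subseteq> S \<and> A \<subseteq> f ` B"
proof -
  obtain g where g: "inj_on g A" "g ` A \<subseteq> B"
    using card_le_inj[OF assms(1,2,4)] by blast
  define s where "s = (SOME s. s \<in> S)"
  have s: "B \<noteq> {} \<Longrightarrow> s \<in> S" unfolding s_def using assms(5) by (simp add: some_in_eq)
  define f where "f b = (if b \<in> g ` A then inv_into A g b else s)" for b
  have "f b \<in> S" if "b \<in> B" for b
    using s assms(3) inv_into_into[of b g A] that unfolding f_def by auto
  then have "f ` B \<subseteq> S" by blast
  moreover have "A \<subseteq> f ` B"
  proof
    fix a assume "a \<in> A"
    then have "f (g a) = a" "g a \<in> B" using g by (auto simp: f_def)
    then show "a \<in> f ` B" by force
  qed
  ultimately show ?thesis by blast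
qed

text \<open>Conversely an embedding can be prescribed by its profiles: each cell only has to be large enough
  to realise the profiles assigned to it, and the surplus elements of the cell may repeat any
  profile that is legal there. All adjacency statements below reduce to this count.\<close>
lemma joint_copy_if_profiles_fit:
  assumes "finite X" "F \<subseteq> X" "G \<subseteq> X" "u \<in> P" "v \<in> P"
    and sub: "\<And>b c. \<A> b c \<subseteq> profiles P r u v b c"
    and fin: "\<And>b c. finite (\<A> b c)"
    and fit: "\<And>b c. card (\<A> b c) \<le> card (cell X F G b c)"
    and ne: "\<And>b c. cell X F G b c \<noteq> {} \<Longrightarrow> profiles P r u v b c \<noteq> {}"
    and sep: "\<And>x y. x \<in> P \<Longrightarrow> y \<in> P \<Longrightarrow> (x, y) \<notin> r \<Longrightarrow> \<exists>b c. \<exists>U\<in>\<A> b c. x \<in> U \<and> y \<notin> U"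
  shows "joint_copy P r X F G"
proof -
  have "\<exists>f. f ` cell X F G b c \<subseteq> profiles P r u v b c \<and> \<A> b c \<subseteq> f ` cell X F G b c" for b c
  proof (rule exists_cover_into[OF fin _ sub fit ne])
    show "finite (cell X F G b c)" using assms(1) by (simp add: cell_def)
  qed
  note ex = this
  define f where "f b c = (SOME f. f ` cell X F G b c \<subseteq> profiles P r u v b c \<and>
    \<A> b c \<subseteq> f ` cell X F G b c)" for b c
  have f: "f b c ` cell X F G b c \<subseteq> profiles P r u v b c" "\<A> b c \<subseteq> f b c ` cell X F G b c" for b c
    using someI_ex[OF ex[of b c]] unfolding f_def by simp_all
  define \<pi> where "\<pi> e = f (e \<in> F) (e \<in> G) e" for e
  define \<iota> where "\<iota> p = {e \<in> X. p \<in> \<pi> e}" for p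
  have pi: "\<pi> e \<in> profiles P r u v (e \<in> F) (e \<in> G)" if "e \<in> X" for e
  proof -
    have "e \<in> cell X F G (e \<in> F) (e \<in> G)" using that by (simp add: cell_def)
    then show ?thesis unfolding \<pi>_def using f(1)[of "e \<in> F" "e \<in> G"] by blast
  qed
  have "u \<in> \<pi> e \<longleftrightarrow> e \<in> F" "v \<in> \<pi> e \<longleftrightarrow> e \<in> G" if "e \<in> X" for e
    using pi[OF that] unfolding profiles_def by simp_all
  then have "\<iota> u = F" "\<iota> v = G"
    using assms(2,3) unfolding \<iota>_def by blast+
  moreover have "(p, q) \<in> r \<longleftrightarrow> \<iota> p \<subseteq> \<iota> q" if "p \<in> P" "q \<in> P" for p q
  proof
    assume "(p, q) \<in> r"
    then have "q \<in> \<pi> e" if "e \<in> X" "p \<in> \<pi> e" for e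
      using pi[OF that(1)] that(2) \<open>q \<in> P\<close> unfolding profiles_def by simp
    then show "\<iota> p \<subseteq> \<iota> q" unfolding \<iota>_def by blast
  next
    assume le: "\<iota> p \<subseteq> \<iota> q"
    show "(p, q) \<in> r"
    proof (rule ccontr)
      assume "(p, q) \<notin> r"
      from sep[OF that this] obtain b c U where U: "U \<in> \<A> b c" "p \<in> U" "q \<notin> U" by auto
      have "U \<in> f b c ` cell X F G b c" using f(2)[of b c] U(1) by (rule subsetD)
      then obtain e where e: "e \<in> cell X F G b c" "U = f b c e" by (rule imageE)
      then have "\<pi> e = U" "e \<in> X" by (auto simp: \<pi>_def cell_def)
      with U have "e \<in> \<iota> p" "e \<notin> \<iota> q" unfolding \<iota>_def by simp_all
      with le show False by blast
    qed
  qed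
  moreover have "\<iota> p \<subseteq> X" for p unfolding \<iota>_def by blast
  ultimately show ?thesis unfolding joint_copy_def using assms(4,5)
    by (intro exI[of _ \<iota>]) auto
qed

text \<open>There are at most \<open>2 ^ card P\<close> profiles, so cells beyond that size only repeat profiles. Hence
  adjacency depends only on the cell sizes truncated at this bound, and it is monotone in them.
  The cells \<open>F - G\<close> and \<open>G - F\<close> must not become inhabited, because this would change the order
  relation between the two sets; the other two cells always admit the constant profiles.\<close>
lemma joint_copy_transfer:
  assumes P: "finite_poset P r" and jc: "joint_copy P r X F G"
    and fin: "finite X" "finite X'" "F' \<subseteq> X'" "G' \<subseteq> X'"
    and size: "\<And>b c. min (card (cell X F G b c)) (2 ^ card P) \<le> card (cell X' F' G' b c)"
    and diff: "cell X F G True False = {} \<Longrightarrow> cell X' F' G' True False = {}"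
      "cell X F G False True = {} \<Longrightarrow> cell X' F' G' False True = {}"
  shows "joint_copy P r X' F' G'"
proof -
  obtain \<iota> u v where i: "\<forall>p\<in>P. \<iota> p \<subseteq> X" "\<And>p q. p \<in> P \<Longrightarrow> q \<in> P \<Longrightarrow> (p, q) \<in> r \<longleftrightarrow> \<iota> p \<subseteq> \<iota> q"
    "u \<in> P" "v \<in> P" "F = \<iota> u" "G = \<iota> v" using jc unfolding joint_copy_def by blast
  note P = finite_posetD[OF P]
  define \<pi> where "\<pi> e = {p \<in> P. e \<in> \<iota> p}" for e
  define \<A> where "\<A> b c = \<pi> ` cell X F G b c" for b c
  have fc: "finite (cell X F G b c)" for b c using fin by (simp add: cell_def)
  have sub: "\<A> b c \<subseteq> profiles P r u v b c" for b c
    using i(2-4) unfolding \<A>_def \<pi>_def profiles_def cell_def i(5,6) by auto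
  show ?thesis
  proof (rule joint_copy_if_profiles_fit[OF fin(2-4) i(3,4) sub])
    fix b c
    show "finite (\<A> b c)" unfolding \<A>_def using fc by blast
    have "\<A> b c \<subseteq> Pow P" unfolding \<A>_def \<pi>_def by blast
    then have "card (\<A> b c) \<le> 2 ^ card P"
      using card_mono[of "Pow P" "\<A> b c"] P(1) by (simp add: card_Pow)
    moreover have "card (\<A> b c) \<le> card (cell X F G b c)"
      unfolding \<A>_def using fc by (rule card_image_le)
    ultimately show "card (\<A> b c) \<le> card (cell X' F' G' b c)" using size[of b c] by linarith
    assume ne: "cell X' F' G' b c \<noteq> {}"
    show "profiles P r u v b c \<noteq> {}"
    proof (cases "b = c")
      case True
      then have "(if b then P else {}) \<in> profiles P r u v b c"
        using i(3,4) unfolding profiles_def by auto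
      then show ?thesis by blast
    next
      case False
      then have "cell X F G b c \<noteq> {}" using diff ne by (cases b; cases c) auto
      then show ?thesis using sub[of b c] unfolding \<A>_def by blast
    qed
  next
    fix x y assume "x \<in> P" "y \<in> P" "(x, y) \<notin> r"
    then obtain e where e: "e \<in> \<iota> x" "e \<notin> \<iota> y" using i(2) by blast
    then have "\<pi> e \<in> \<A> (e \<in> F) (e \<in> G)" using i(1) \<open>x \<in> P\<close> unfolding \<A>_def cell_def by blast
    moreover have "x \<in> \<pi> e" "y \<notin> \<pi> e" using e \<open>x \<in> P\<close> unfolding \<pi>_def by auto
    ultimately show "\<exists>b c. \<exists>U\<in>\<A> b c. x \<in> U \<and> y \<notin> U" by blast
  qed
qed

text \<open>The principal up-sets separate all pairs and there are only \<open>card P\<close> of them. So they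
  embed the poset as soon as each cell has room for those principal up-sets that are legal in it.\<close>
lemma joint_copy_principal:
  assumes P: "finite_poset P r" and fin: "finite X" "F \<subseteq> X" "G \<subseteq> X" "u \<in> P" "v \<in> P"
    and fit: "\<And>b c. card {x \<in> P. ((x, u) \<in> r \<longleftrightarrow> b) \<and> ((x, v) \<in> r \<longleftrightarrow> c)} \<le> card (cell X F G b c)"
    and ne: "\<And>b c. b \<noteq> c \<Longrightarrow> cell X F G b c \<noteq> {} \<Longrightarrow> \<exists>x\<in>P. ((x, u) \<in> r \<longleftrightarrow> b) \<and> ((x, v) \<in> r \<longleftrightarrow> c)"
  shows "joint_copy P r X F G"
proof -
  note P = finite_posetD[OF P]
  define up where "up x = {y \<in> P. (x, y) \<in> r}" for x
  define B where "B b c = {x \<in> P. ((x, u) \<in> r \<longleftrightarrow> b) \<and> ((x, v) \<in> r \<longleftrightarrow> c)}" for b c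
  have fB: "finite (B b c)" for b c unfolding B_def using P(1) by simp
  have sub: "up ` B b c \<subseteq> profiles P r u v b c" for b c
  proof
    fix U assume "U \<in> up ` B b c"
    then obtain x where x: "x \<in> B b c" "U = up x" by blast
    have "z \<in> up x" if "y \<in> up x" "z \<in> P" "(y, z) \<in> r" for y z
      using that P(4)[of x y z] unfolding up_def by simp
    moreover have "u \<in> up x \<longleftrightarrow> b" "v \<in> up x \<longleftrightarrow> c" "up x \<subseteq> P"
      using x(1) fin(4,5) unfolding up_def B_def by auto
    ultimately show "U \<in> profiles P r u v b c" unfolding x(2) profiles_def by blast
  qed
  show ?thesis
  proof (rule joint_copy_if_profiles_fit[OF fin sub])
    fix b c
    show "finite (up ` B b c)" using fB by blast
    show "card (up ` B b c) \<le> card (cell X F G b c)"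
      using card_image_le[OF fB, of up b c] fit[of b c] unfolding B_def by linarith
    assume ne': "cell X F G b c \<noteq> {}"
    show "profiles P r u v b c \<noteq> {}"
    proof (cases "b = c")
      case True
      then have "(if b then P else {}) \<in> profiles P r u v b c"
        using fin(4,5) unfolding profiles_def by auto
      then show ?thesis by blast
    next
      case False
      from ne[OF this ne'] have "B b c \<noteq> {}" unfolding B_def by auto
      then show ?thesis using sub[of b c] by blast
    qed
  next
    fix x y assume xy: "x \<in> P" "y \<in> P" "(x, y) \<notin> r"
    then have "up x \<in> up ` B ((x, u) \<in> r) ((x, v) \<in> r)" unfolding B_def by simp
    moreover have "x \<in> up x" "y \<notin> up x" using xy P(2) unfolding up_def by auto
    ultimately have "\<exists>U\<in>up ` B ((x, u) \<in> r) ((x, v) \<in> r). x \<in> U \<and> y \<notin> U" by (intro bexI conjI)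
    then show "\<exists>b c. \<exists>U\<in>up ` B b c. x \<in> U \<and> y \<notin> U" by (intro exI)
  qed
qed

text \<open>Any relation \<open>u < v\<close> of the poset serves: no principal up-set contains \<open>u\<close> but not \<open>v\<close>, so the
  empty cell \<open>F - G\<close> needs no room.\<close>
lemma joint_copy_comparable:
  assumes P: "finite_poset P r" "\<not> poset_antichain P r" and fin: "finite X" "F \<subseteq> G" "G \<subseteq> X"
    and size: "card P \<le> card F" "card P \<le> card (G - F)" "card P \<le> card (X - G)"
  shows "joint_copy P r X F G"
proof -
  note P' = finite_posetD[OF P(1)]
  obtain u v where uv: "u \<in> P" "v \<in> P" "(u, v) \<in> r" "u \<noteq> v"
    using P(2) unfolding poset_antichain_def by blast
  have cells: "cell X F G True True = F" "cell X F G False True = G - F"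
    "cell X F G False False = X - G" "cell X F G True False = {}"
    using fin unfolding cell_def by auto
  show ?thesis
  proof (rule joint_copy_principal[OF P(1) fin(1) _ fin(3) uv(1,2)])
    show "F \<subseteq> X" using fin by blast
    fix b c
    have le: "card {x \<in> P. ((x, u) \<in> r \<longleftrightarrow> b) \<and> ((x, v) \<in> r \<longleftrightarrow> c)} \<le> card P"
      using P'(1) by (intro card_mono) auto
    have none: "{x \<in> P. (x, u) \<in> r \<and> (x, v) \<notin> r} = {}" using P'(4) uv(3) by blast
    show "card {x \<in> P. ((x, u) \<in> r \<longleftrightarrow> b) \<and> ((x, v) \<in> r \<longleftrightarrow> c)} \<le> card (cell X F G b c)"
    proof (cases "b \<and> \<not> c")
      case True
      then show ?thesis using none by (simp del: Collect_empty_eq)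
    next
      case False
      then show ?thesis using le size by (cases b; cases c) (auto simp: cells)
    qed
    assume "b \<noteq> c" "cell X F G b c \<noteq> {}"
    then have "\<not> b" "c" using cells(4) by auto
    then show "\<exists>x\<in>P. ((x, u) \<in> r \<longleftrightarrow> b) \<and> ((x, v) \<in> r \<longleftrightarrow> c)"
      using uv P'(2,3) by blast
  qed
qed

text \<open>Among the incomparable pairs take one with the fewest elements below it. An element strictly below
  one member but not below the other would be incomparable to the other and give a smaller pair.\<close>
lemma exists_incomparable_pair_same_below:
  assumes P: "finite_poset P r" "\<not> poset_chain P r"
  shows "\<exists>u\<in>P. \<exists>v\<in>P. (u, v) \<notin> r \<and> (v, u) \<notin> r \<and>
    (\<forall>x\<in>P. (x, u) \<in> r \<longrightarrow> x \<noteq> u \<longrightarrow> (x, v) \<in> r) \<and> (\<forall>x\<in>P. (x, v) \<in> r \<longrightarrow> x \<noteq> v \<longrightarrow> (x, u) \<in> r)"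
proof -
  note P' = finite_posetD[OF P(1)]
  define dn where "dn u = {x \<in> P. (x, u) \<in> r}" for u
  have less: "card (dn x) < card (dn u)" if "x \<in> P" "u \<in> P" "(x, u) \<in> r" "x \<noteq> u" for x u
  proof (rule psubset_card_mono)
    show "finite (dn u)" unfolding dn_def using P'(1) by simp
    show "dn x \<subset> dn u" using that P'(2-4) unfolding dn_def by blast
  qed
  define Q where "Q = (\<lambda>(u, v). u \<in> P \<and> v \<in> P \<and> (u, v) \<notin> r \<and> (v, u) \<notin> r)"
  obtain w where "Q w" using P(2) unfolding poset_chain_def Q_def by auto
  from ex_has_least_nat[of Q w "\<lambda>(u, v). card (dn u) + card (dn v)", OF this]
  obtain u v where uv: "Q (u, v)"
    and min: "\<And>u' v'. Q (u', v') \<Longrightarrow> card (dn u) + card (dn v) \<le> card (dn u') + card (dn v')"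
    by auto
  have "(x, v) \<in> r" if "x \<in> P" "(x, u) \<in> r" "x \<noteq> u" for x
  proof (rule ccontr)
    assume "(x, v) \<notin> r"
    then have "Q (x, v)" using uv that P'(4) unfolding Q_def by blast
    with min less[of x u] that uv show False unfolding Q_def by fastforce
  qed
  moreover have "(x, u) \<in> r" if "x \<in> P" "(x, v) \<in> r" "x \<noteq> v" for x
  proof (rule ccontr)
    assume "(x, u) \<notin> r"
    then have "Q (u, x)" using uv that P'(4) unfolding Q_def by blast
    with min less[of x v] that uv show False unfolding Q_def by fastforce
  qed
  ultimately show ?thesis using uv unfolding Q_def by blast
qed

text \<open>For a pair as above the only principal up-set with \<open>u\<close> but not \<open>v\<close> is that of \<open>u\<close>; so one element
  of \<open>F - G\<close>, and likewise one of \<open>G - F\<close>, is enough.\<close>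
lemma joint_copy_incomparable:
  assumes P: "finite_poset P r" "\<not> poset_chain P r" and fin: "finite X" "F \<subseteq> X" "G \<subseteq> X"
    and inc: "\<not> F \<subseteq> G" "\<not> G \<subseteq> F"
    and size: "card P \<le> card (F \<inter> G)" "card P \<le> card (X - (F \<union> G))"
  shows "joint_copy P r X F G"
proof -
  note P' = finite_posetD[OF P(1)]
  obtain u v where uv: "u \<in> P" "v \<in> P" "(u, v) \<notin> r" "(v, u) \<notin> r"
    and lo: "\<forall>x\<in>P. (x, u) \<in> r \<longrightarrow> x \<noteq> u \<longrightarrow> (x, v) \<in> r" "\<forall>x\<in>P. (x, v) \<in> r \<longrightarrow> x \<noteq> v \<longrightarrow> (x, u) \<in> r"
    using exists_incomparable_pair_same_below[OF P] by blast
  have cells: "cell X F G True True = F \<inter> G" "cell X F G False True = G - F"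
    "cell X F G False False = X - (F \<union> G)" "cell X F G True False = F - G"
    using fin unfolding cell_def by auto
  have "finite (F - G)" "finite (G - F)" "F - G \<noteq> {}" "G - F \<noteq> {}"
    using inc fin by (auto dest: finite_subset)
  then have ne: "card (F - G) \<ge> 1" "card (G - F) \<ge> 1"
    by (auto simp: Suc_le_eq card_gt_0_iff)
  show ?thesis
  proof (rule joint_copy_principal[OF P(1) fin uv(1,2)])
    fix b c
    have le: "card {x \<in> P. ((x, u) \<in> r \<longleftrightarrow> b) \<and> ((x, v) \<in> r \<longleftrightarrow> c)} \<le> card P"
      using P'(1) by (intro card_mono) auto
    have one: "{x \<in> P. (x, u) \<in> r \<and> (x, v) \<notin> r} = {u}" "{x \<in> P. (x, u) \<notin> r \<and> (x, v) \<in> r} = {v}"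
      using lo uv P'(2) by blast+
    show "card {x \<in> P. ((x, u) \<in> r \<longleftrightarrow> b) \<and> ((x, v) \<in> r \<longleftrightarrow> c)} \<le> card (cell X F G b c)"
      using le size ne one by (cases b; cases c) (auto simp: cells)
    assume "b \<noteq> c"
    then show "\<exists>x\<in>P. ((x, u) \<in> r \<longleftrightarrow> b) \<and> ((x, v) \<in> r \<longleftrightarrow> c)"
      using uv P'(2) by (cases b) auto
  qed
qed

section \<open>The middle layers and independent sets\<close>

lemma independent_in_middle_iff:
  assumes "finite_poset P r"
  shows "independent_in (induced (copy_graph P r n) (middle n)) I \<longleftrightarrow>
    I \<subseteq> middle n \<and> (\<forall>F\<in>I. \<forall>G\<in>I. F \<noteq> G \<longrightarrow> \<not> joint_copy P r {1..n} F G)"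
proof -
  let ?E = "snd (induced (copy_graph P r n) (middle n))"
  have sub: "middle n \<subseteq> Pow {1..n}" unfolding middle_def by blast
  have edge: "{F, G} \<in> ?E \<longleftrightarrow> F \<noteq> G \<and> joint_copy P r {1..n} F G"
    if "F \<in> middle n" "G \<in> middle n" for F G
  proof -
    have "{F, G} \<in> ?E \<longleftrightarrow> (\<exists>F' G'. {F, G} = {F', G'} \<and> F' \<noteq> G' \<and> joint_copy P r {1..n} F' G')"
      using that unfolding induced_def copy_graph_def joint_copy_iff_strong_copy[OF assms] by simp
    also have "\<dots> \<longleftrightarrow> F \<noteq> G \<and> joint_copy P r {1..n} F G"
      using joint_copy_sym[of P r "{1..n}" F G] by (auto simp: doubleton_eq_iff)
    finally show ?thesis .
  qed
  have vert: "fst (induced (copy_graph P r n) (middle n)) = middle n"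
    using sub unfolding induced_def copy_graph_def by auto
  show ?thesis unfolding independent_in_def vert using edge by (meson subsetD)
qed

lemma finite_middle: "finite (middle n)"
  by (rule finite_subset[of _ "Pow {1..n}"]) (auto simp: middle_def)

lemma finite_independent_sets: "finite {I. independent_in (induced (copy_graph P r n) (middle n)) I}"
  by (rule finite_subset[of _ "Pow (middle n)"])
    (auto simp: finite_middle independent_in_def induced_def)

lemma card_le_independence_number:
  assumes "independent_in (induced (copy_graph P r n) (middle n)) I"
  shows "card I \<le> independence_number (induced (copy_graph P r n) (middle n))"
  unfolding independence_number_def
  using assms finite_independent_sets by (intro Max_ge) auto

lemma independence_number_attained:
  "\<exists>I. independent_in (induced (copy_graph P r n) (middle n)) I \<and>
       card I = independence_number (induced (copy_graph P r n) (middle n))"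
proof -
  have "{} \<in> {I. independent_in (induced (copy_graph P r n) (middle n)) I}"
    by (simp add: independent_in_def)
  then have "independence_number (induced (copy_graph P r n) (middle n))
      \<in> card ` {I. independent_in (induced (copy_graph P r n) (middle n)) I}"
    unfolding independence_number_def by (intro Max_in finite_imageI finite_independent_sets) blast
  then show ?thesis by auto
qed

lemma powr_two_thirds_ge:
  assumes "k ^ 3 \<le> n"
  shows "real k ^ 2 \<le> real n powr (2 / 3)"
proof (cases "k = 0")
  case False
  have "(real k ^ 3) powr (2 / 3) = (real k powr 3) powr (2 / 3)"
    using False by (simp add: powr_realpow[of _ 3, simplified])
  then have "real k ^ 2 = (real k ^ 3) powr (2 / 3)"
    using False powr_realpow[of "real k" 2] by (simp only: powr_powr) simp
  also have "\<dots> \<le> real n powr (2 / 3)"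
  proof (rule powr_mono2)
    have "real (k ^ 3) \<le> real n" using assms by (rule of_nat_mono)
    then show "real k ^ 3 \<le> real n" by simp
  qed auto
  finally show ?thesis .
qed simp

lemma powr_two_thirds_le:
  assumes "n \<ge> 8000"
  shows "real n powr (2 / 3) \<le> real n / 20"
proof -
  have "(20::real) = (20 ^ 3) powr (1 / 3)" by (simp add: powr_powr flip: powr_numeral)
  also have "\<dots> \<le> real n powr (1 / 3)" using assms by (intro powr_mono2) auto
  finally have "20 * real n powr (2 / 3) \<le> real n powr (1 / 3) * real n powr (2 / 3)"
    by (intro mult_right_mono) auto
  also have "\<dots> = real n" using assms by (simp flip: powr_add)
  finally show ?thesis by simp
qed

text \<open>With \<open>8000 = 20 ^ 3\<close> as a threshold the sizes in the middle layers lie between \<open>9 * n / 20\<close> and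
  \<open>11 * n / 20\<close>; with these concrete bounds all later size comparisons are linear.\<close>
lemma middle_card_bounds:
  assumes "n \<ge> 8000" "F \<in> middle n"
  shows "9 * n \<le> 20 * card F" "20 * card F \<le> 11 * n"
  using powr_two_thirds_le[OF assms(1)] assms(2) unfolding middle_def by auto

lemma middle_subset: "F \<in> middle n \<Longrightarrow> F \<subseteq> {1..n}"
  unfolding middle_def by blast

lemma card_compl_interval: "F \<subseteq> {1..n} \<Longrightarrow> card ({1..n} - F) = n - card F"
  by (simp add: card_Diff_subset finite_subset)

lemma middle_compl: "F \<in> middle n \<Longrightarrow> {1..n} - F \<in> middle n"
proof -
  assume F: "F \<in> middle n"
  then have "card F \<le> n" using card_mono[of "{1..n}" F] middle_subset by force
  then have "\<bar>real (card ({1..n} - F)) - real n / 2\<bar> = \<bar>real (card F) - real n / 2\<bar>"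
    unfolding card_compl_interval[OF middle_subset[OF F]] by (simp add: of_nat_diff abs_if)
  with F show ?thesis unfolding middle_def by simp
qed

text \<open>The sizes of the members of a chain are distinct, so its cardinality is bounded by
  the size difference of its extreme members.\<close>
lemma chain_extremes:
  fixes C :: "nat set set"
  assumes "finite C" "C \<noteq> {}" "\<And>A. A \<in> C \<Longrightarrow> finite A"
    "\<And>A B. A \<in> C \<Longrightarrow> B \<in> C \<Longrightarrow> A \<subseteq> B \<or> B \<subseteq> A"
  shows "\<exists>A\<in>C. \<exists>B\<in>C. A \<subseteq> B \<and> card C \<le> card B - card A + 1"
proof -
  have inj: "inj_on card C"
  proof (rule inj_onI)
    fix A B assume "A \<in> C" "B \<in> C" "card A = card B"
    then show "A = B" using assms(4)[of A B] assms(3) card_subset_eq[of A B] card_subset_eq[of B A] by auto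
  qed
  let ?S = "card ` C"
  have S: "finite ?S" "?S \<noteq> {}" using assms by auto
  from Min_in[OF S] obtain A where A: "A \<in> C" "card A = Min ?S" by force
  from Max_in[OF S] obtain B where B: "B \<in> C" "card B = Max ?S" by force
  have le: "card A \<le> card B" using A B S by simp
  have "A \<subseteq> B"
    using assms(4)[OF A(1) B(1)] le card_subset_eq[of A B] card_seteq[of A B] assms(3) A(1) B(1) by blast
  moreover have "?S \<subseteq> {card A..card B}" using A B S by auto
  then have "card ?S \<le> Suc (card B) - card A" using card_mono[of "{card A..card B}"] by fastforce
  then have "card C \<le> card B - card A + 1" using card_image[OF inj] le by simp
  ultimately show ?thesis using A(1) B(1) by blast
qed

section \<open>Standard examples realise every independence number\<close>

text \<open>The standard example \<open>S\<^sub>N\<close> of order dimension theory; \<open>N + i\<close> is the maximal element that is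
  incomparable to the minimal element \<open>i\<close>.\<close>
definition standard_example :: "nat \<Rightarrow> nat rel" where
  "standard_example N =
     {(a, b). a < 2 * N \<and> b < 2 * N \<and> (a = b \<or> (a < N \<and> N \<le> b \<and> b \<noteq> N + a))}"

lemma finite_poset_standard_example: "finite_poset {..<2 * N} (standard_example N)"
  unfolding finite_poset_def partial_order_on_def preorder_on_def
  by (auto simp: standard_example_def intro!: refl_onI antisymI transI)

text \<open>If \<open>N \<ge> 3\<close>, the relations between minimal and maximal elements already force all other
  non-inclusions: for instance \<open>Y i \<subseteq> Y j \<subseteq> Z i\<close> is impossible.\<close>
lemma joint_copy_standard_exampleI:
  assumes N: "N \<ge> 3"
    and sub: "\<And>i. i < N \<Longrightarrow> Y i \<subseteq> X" "\<And>i. i < N \<Longrightarrow> Z i \<subseteq> X"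
    and YZ: "\<And>i j. i < N \<Longrightarrow> j < N \<Longrightarrow> Y i \<subseteq> Z j \<longleftrightarrow> i \<noteq> j"
    and F: "F \<in> Y ` {..<N} \<union> Z ` {..<N}" and G: "G \<in> Y ` {..<N} \<union> Z ` {..<N}"
  shows "joint_copy {..<2 * N} (standard_example N) X F G"
proof -
  define \<iota> where "\<iota> p = (if p < N then Y p else Z (p - N))" for p
  have YY: "\<not> Y i \<subseteq> Y j" if "i < N" "j < N" "i \<noteq> j" for i j
    using YZ[of j i] YZ[of i i] that by blast
  have ZZ: "\<not> Z i \<subseteq> Z j" if "i < N" "j < N" "i \<noteq> j" for i j
    using YZ[of j i] YZ[of j j] that by blast
  have ZY: "\<not> Z i \<subseteq> Y j" if ij: "i < N" "j < N" for i j
  proof -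
    have "\<exists>k\<in>{0,1,2}. k \<noteq> i \<and> k \<noteq> j" by auto
    then obtain k where k: "k \<in> {0,1,2}" "k \<noteq> i" "k \<noteq> j" by blast
    then have "k < N" using N by auto
    then show ?thesis using YZ[of k i] YY[of k j] k ij by blast
  qed
  have img: "\<iota> ` {..<2 * N} = Y ` {..<N} \<union> Z ` {..<N}"
  proof (intro equalityI subsetI)
    fix A assume "A \<in> Y ` {..<N} \<union> Z ` {..<N}"
    then obtain i where i: "i < N" "A = \<iota> i \<or> A = \<iota> (N + i)" unfolding \<iota>_def by auto
    then show "A \<in> \<iota> ` {..<2 * N}" by auto
  qed (auto simp: \<iota>_def)
  have "(p, q) \<in> standard_example N \<longleftrightarrow> \<iota> p \<subseteq> \<iota> q" if "p < 2 * N" "q < 2 * N" for p q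
  proof (cases "p < N"; cases "q < N")
    assume "p < N" "q < N"
    then show ?thesis using YY[of p q] by (auto simp: \<iota>_def standard_example_def)
  next
    assume "p < N" "\<not> q < N"
    then show ?thesis using YZ[of p "q - N"] that by (auto simp: \<iota>_def standard_example_def)
  next
    assume "\<not> p < N" "q < N"
    then show ?thesis using ZY[of "p - N" q] that by (auto simp: \<iota>_def standard_example_def)
  next
    assume "\<not> p < N" "\<not> q < N"
    moreover have "p - N = q - N \<longleftrightarrow> p = q" "p - N < N" "q - N < N"
      using that \<open>\<not> p < N\<close> \<open>\<not> q < N\<close> by linarith+
    ultimately show ?thesis
      using ZZ[of "p - N" "q - N"] that by (auto simp: \<iota>_def standard_example_def)
  qed
  moreover have "\<iota> p \<subseteq> X" if "p < 2 * N" for p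
    using sub(1)[of p] sub(2)[of "p - N"] that by (auto simp: \<iota>_def)
  ultimately show ?thesis unfolding joint_copy_def
    using F G img by (intro exI[of _ \<iota>]) auto
qed

text \<open>If \<open>F = Y i\<close> and \<open>G = Z j\<close>, then for each of the other \<open>N - 2\<close> indices \<open>k\<close> a witness of
  \<open>\<not> Y k \<subseteq> Z k\<close> lies in \<open>G\<close> and outside \<open>F\<close>; it belongs to \<open>Z l\<close> for all \<open>l \<noteq> k\<close>, so these witnesses are distinct.\<close>
lemma standard_example_gap:
  assumes jc: "joint_copy {..<2 * N} (standard_example N) X F G" and "F \<subset> G" "finite G"
  shows "N - 2 \<le> card (G - F)"
proof -
  obtain \<iota> p q where i: "\<And>p q. p < 2 * N \<Longrightarrow> q < 2 * N \<Longrightarrow> (p, q) \<in> standard_example N \<longleftrightarrow> \<iota> p \<subseteq> \<iota> q"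
    "p < 2 * N" "q < 2 * N" "F = \<iota> p" "G = \<iota> q" using jc unfolding joint_copy_def by auto
  have "(p, q) \<in> standard_example N" "p \<noteq> q" using i(1)[OF i(2,3)] assms(2) i(4,5) by auto
  then have pq: "p < N" "N \<le> q" "q \<noteq> N + p" by (auto simp: standard_example_def)
  let ?K = "{..<N} - {p, q - N}"
  have le: "\<iota> k \<subseteq> \<iota> (N + l) \<longleftrightarrow> k \<noteq> l" if "k < N" "l < N" for k l
    using i(1)[of k "N + l"] that by (auto simp: standard_example_def)
  have "\<exists>e. e \<in> \<iota> k \<and> e \<notin> \<iota> (N + k)" if "k \<in> ?K" for k
    using le[of k k] that by auto
  then obtain e where e: "\<And>k. k \<in> ?K \<Longrightarrow> e k \<in> \<iota> k \<and> e k \<notin> \<iota> (N + k)" by metis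
  have "inj_on e ?K"
  proof (rule inj_onI, rule ccontr)
    fix k l assume "k \<in> ?K" "l \<in> ?K" "e k = e l" "k \<noteq> l"
    then show False using e[of k] e[of l] le[of k l] by auto
  qed
  moreover have "e ` ?K \<subseteq> G - F"
  proof
    fix x assume "x \<in> e ` ?K"
    then obtain k where k: "k \<in> ?K" "x = e k" by blast
    then have "k \<noteq> p" "k \<noteq> q - N" "k < N" by auto
    moreover have "q - N < N" "N + (q - N) = q" using pq(2) i(3) by auto
    ultimately have "\<iota> k \<subseteq> \<iota> q" "\<iota> p \<subseteq> \<iota> (N + k)"
      using le[of k "q - N"] le[of p k] pq by auto
    then show "x \<in> G - F" using e[OF k(1)] k(2) i(4,5) by auto
  qed
  ultimately have "card ?K \<le> card (G - F)" using assms(3) by (intro card_inj_on_le) auto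
  moreover have "N - 2 \<le> card ?K"
    using diff_card_le_card_Diff[of "{p, q - N}" "{..<N}"] card_insert_le_m1[of 2 "{q - N}" p] by simp
  ultimately show ?thesis by linarith
qed

lemma obtain_injection_from:
  assumes "finite S" "b - a \<le> card S"
  obtains e :: "nat \<Rightarrow> 'b" where "inj_on e {a..<b}" "\<And>i. a \<le> i \<Longrightarrow> i < b \<Longrightarrow> e i \<in> S"
proof -
  obtain e where "e ` {a..<b} \<subseteq> S" "inj_on e {a..<b}"
    using card_le_inj[of "{a..<b}" S] assms by auto
  then show ?thesis by (intro that[of e]) auto
qed

lemma standard_example_comparable:
  assumes N: "N \<ge> 3" and X: "finite X" "F \<subseteq> G" "G \<subseteq> X" "F \<noteq> {}" "G \<noteq> X"
    and size: "N - 2 \<le> card (G - F)"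
  shows "joint_copy {..<2 * N} (standard_example N) X F G"
proof -
  obtain e where e: "inj_on e {2..<N}" "\<And>i. 2 \<le> i \<Longrightarrow> i < N \<Longrightarrow> e i \<in> G - F"
    using obtain_injection_from[of "G - F" N 2] size X finite_subset by blast
  obtain f g where fg: "f \<in> F" "g \<in> X" "g \<notin> G" using X by blast
  define Y where "Y i = (if i = 0 then F else if i = 1 then {g} else {e i})" for i
  define Z where "Z i = (if i = 0 then X - {f} else if i = 1 then G else X - {e i})" for i
  show ?thesis
  proof (rule joint_copy_standard_exampleI[OF N, of Y X Z])
    fix i assume "i < N"
    then show "Y i \<subseteq> X" "Z i \<subseteq> X" using e(2)[of i] fg X unfolding Y_def Z_def by auto
  next
    fix i j assume ij: "i < N" "j < N"
    have ne: "e i \<noteq> e j" if "2 \<le> i" "2 \<le> j" "i \<noteq> j" using that ij e(1) by (auto dest: inj_onD)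
    consider "i = 0" | "i = 1" | "2 \<le> i" by linarith
    then show "Y i \<subseteq> Z j \<longleftrightarrow> i \<noteq> j"
      using e(2)[of i] e(2)[of j] fg X ij ne unfolding Y_def Z_def by cases auto
  next
    have "F = Y 0" "G = Z 1" unfolding Y_def Z_def by auto
    then show "F \<in> Y ` {..<N} \<union> Z ` {..<N}" "G \<in> Y ` {..<N} \<union> Z ` {..<N}" using N by auto
  qed
qed

text \<open>Incomparable sets are adjacent as \<open>Y 0, Z 0\<close> or as \<open>Z 0, Z 1\<close>, and one of the two requirements on
  the cells holds as soon as \<open>G\<close> has \<open>2 * N\<close> elements.\<close>
lemma standard_example_incomparable:
  assumes N: "N \<ge> 3" and X: "finite X" "F \<subseteq> X" "G \<subseteq> X" "\<not> F \<subseteq> G" "\<not> G \<subseteq> F"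
    and size: "2 * N \<le> card G"
  shows "joint_copy {..<2 * N} (standard_example N) X F G"
proof -
  have fin: "finite F" "finite G" using X finite_subset by auto
  obtain f g where fg: "f \<in> F" "f \<notin> G" "g \<in> G" "g \<notin> F" using X by blast
  have "card G = card (F \<inter> G) + card (G - F)"
    using card_Int_Diff[OF fin(2), of F] by (simp add: Int_commute)
  then consider "N - 1 \<le> card (G - F)" | "N - 2 \<le> card (F \<inter> G)" using size by linarith
  then show ?thesis
  proof cases
    case 1
    obtain e where e: "inj_on e {1..<N}" "\<And>i. 1 \<le> i \<Longrightarrow> i < N \<Longrightarrow> e i \<in> G - F"
      using obtain_injection_from[of "G - F" N 1] 1 fin by blast
    define Y where "Y i = (if i = 0 then F else {e i})" for i
    define Z where "Z i = (if i = 0 then G else X - {e i})" for i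
    show ?thesis
    proof (rule joint_copy_standard_exampleI[OF N, of Y X Z])
      fix i assume "i < N"
      then show "Y i \<subseteq> X" "Z i \<subseteq> X" using e(2)[of i] X unfolding Y_def Z_def by auto
    next
      fix i j assume ij: "i < N" "j < N"
      have ne: "e i \<noteq> e j" if "1 \<le> i" "1 \<le> j" "i \<noteq> j" using that ij e(1) by (auto dest: inj_onD)
      consider "i = 0" | "1 \<le> i" by linarith
      then show "Y i \<subseteq> Z j \<longleftrightarrow> i \<noteq> j"
        using e(2)[of i] e(2)[of j] fg X ij ne unfolding Y_def Z_def by cases auto
    next
      have "F = Y 0" "G = Z 0" unfolding Y_def Z_def by auto
      then show "F \<in> Y ` {..<N} \<union> Z ` {..<N}" "G \<in> Y ` {..<N} \<union> Z ` {..<N}" using N by auto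
    qed
  next
    case 2
    obtain e where e: "inj_on e {2..<N}" "\<And>i. 2 \<le> i \<Longrightarrow> i < N \<Longrightarrow> e i \<in> F \<inter> G"
      using obtain_injection_from[of "F \<inter> G" N 2] 2 fin by blast
    define Y where "Y i = (if i = 0 then {g} else if i = 1 then {f} else {e i})" for i
    define Z where "Z i = (if i = 0 then F else if i = 1 then G else X - {e i})" for i
    show ?thesis
    proof (rule joint_copy_standard_exampleI[OF N, of Y X Z])
      fix i assume "i < N"
      then show "Y i \<subseteq> X" "Z i \<subseteq> X" using e(2)[of i] fg X unfolding Y_def Z_def by auto
    next
      fix i j assume ij: "i < N" "j < N"
      have ne: "e i \<noteq> e j" if "2 \<le> i" "2 \<le> j" "i \<noteq> j" using that ij e(1) by (auto dest: inj_onD)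
      consider "i = 0" | "i = 1" | "2 \<le> i" by linarith
      then show "Y i \<subseteq> Z j \<longleftrightarrow> i \<noteq> j"
        using e(2)[of i] e(2)[of j] fg X ij ne unfolding Y_def Z_def by cases auto
    next
      have "F = Z 0" "G = Z 1" unfolding Z_def by auto
      then show "F \<in> Y ` {..<N} \<union> Z ` {..<N}" "G \<in> Y ` {..<N} \<union> Z ` {..<N}" using N by auto
    qed
  qed
qed

text \<open>For \<open>S\<^sub>t\<^sub>+\<^sub>2\<close> two sets of the middle layers are non-adjacent exactly if they are comparable and
  differ by fewer than \<open>t\<close> elements; the largest such families are chains of \<open>t\<close> consecutive sizes.\<close>
lemma independence_number_standard_example:
  assumes t: "t > 0" and n: "n \<ge> 8000" "n \<ge> (t + 2) ^ 3"
  shows "independence_number (induced (copy_graph {..<2 * (t + 2)} (standard_example (t + 2)) n) (middle n)) = t"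
    (is "independence_number ?H = t")
proof (rule antisym)
  let ?N = "t + 2"
  let ?jc = "joint_copy {..<2 * ?N} (standard_example ?N) {1..n}"
  note indep = independent_in_middle_iff[OF finite_poset_standard_example]
  have N: "?N \<ge> 3" using t by simp
  have "?N * 9 \<le> ?N * ?N ^ 2" using N power_mono[of 3 ?N 2] by (intro mult_le_mono2) simp
  also have "\<dots> = ?N ^ 3" by (simp only: power3_eq_cube power2_eq_square mult.assoc)
  finally have nN: "9 * ?N \<le> n" using n(2) by linarith
  have big: "2 * ?N \<le> card F" "card F + 2 * ?N \<le> n" "finite F" "F \<subseteq> {1..n}" if "F \<in> middle n" for F
    using middle_card_bounds[OF n(1) that] nN middle_subset[OF that] finite_subset by auto
  obtain I where I: "independent_in ?H I" "card I = independence_number ?H"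
    using independence_number_attained by blast
  then have I': "I \<subseteq> middle n" "\<And>F G. F \<in> I \<Longrightarrow> G \<in> I \<Longrightarrow> F \<noteq> G \<Longrightarrow> \<not> ?jc F G"
    unfolding indep by auto
  show "independence_number ?H \<le> t"
  proof (cases "I = {}")
    case False
    have "F \<subseteq> G \<or> G \<subseteq> F" if "F \<in> I" "G \<in> I" for F G
      using standard_example_incomparable[OF N, of "{1..n}" F G] I' that big by blast
    then obtain A B where AB: "A \<in> I" "B \<in> I" "A \<subseteq> B" "card I \<le> card B - card A + 1"
      using chain_extremes[of I] False I'(1) finite_middle finite_subset big(3) by (metis subsetD)
    have d: "card (B - A) = card B - card A"
      using AB I'(1) big by (intro card_Diff_subset) auto
    have "card (B - A) < t"
    proof (rule ccontr)
      assume "\<not> ?thesis"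
      then have "?N - 2 \<le> card (B - A)" "A \<noteq> B" using t by auto
      moreover have "A \<noteq> {}" "B \<noteq> {1..n}" using big[of A] big[of B] AB I'(1) N by auto
      ultimately show False
        using standard_example_comparable[OF N, of "{1..n}" A B] I' AB big by blast
    qed
    then show ?thesis using AB(4) d I(2) by simp
  qed (use I in auto)
next
  let ?N = "t + 2"
  note indep = independent_in_middle_iff[OF finite_poset_standard_example]
  define A where "A i = {1..n div 2 + i}" for i
  have pw: "real (t + 2) ^ 2 \<le> real n powr (2 / 3)" using powr_two_thirds_ge[OF n(2)] .
  have "real (t + 2) * 1 \<le> real (t + 2) * real (t + 2)" by (intro mult_left_mono) auto
  also have "\<dots> \<le> real n powr (2 / 3)" using pw unfolding power2_eq_square .
  finally have pw: "real (t + 2) \<le> real n powr (2 / 3)" by simp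
  then have "real (t + 2) \<le> real n / 20" using powr_two_thirds_le[OF n(1)] by linarith
  then have "real (20 * (t + 2)) \<le> real n" by simp
  then have tn: "20 * (t + 2) \<le> n" by (simp only: of_nat_le_iff)
  have mid: "A i \<in> middle n" if "i < t" for i
  proof -
    have "real (n div 2) \<le> real n / 2" "real n / 2 \<le> real (n div 2) + 1" by linarith+
    then have "\<bar>real (card (A i)) - real n / 2\<bar> \<le> real (t + 2)"
      using that unfolding A_def by (simp add: abs_le_iff)
    then have "\<bar>real (card (A i)) - real n / 2\<bar> \<le> real n powr (2 / 3)" using pw by linarith
    moreover have "A i \<subseteq> {1..n}" unfolding A_def using that tn by auto
    ultimately show ?thesis unfolding middle_def by blast
  qed
  have non: "\<not> joint_copy {..<2 * ?N} (standard_example ?N) {1..n} (A i) (A j)" if "i < j" "j < t" for i j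
  proof
    assume "joint_copy {..<2 * ?N} (standard_example ?N) {1..n} (A i) (A j)"
    moreover have "A i \<subset> A j" "finite (A j)" using that unfolding A_def by auto
    ultimately have "t \<le> card (A j - A i)" using standard_example_gap by fastforce
    moreover have "card (A j - A i) = j - i"
      using that unfolding A_def by (subst card_Diff_subset) auto
    ultimately show False using that by linarith
  qed
  have "independent_in ?H (A ` {..<t})"
    unfolding indep
  proof (intro conjI ballI impI)
    show "A ` {..<t} \<subseteq> middle n" using mid by auto
    fix F G assume "F \<in> A ` {..<t}" "G \<in> A ` {..<t}" "F \<noteq> G"
    then obtain i j where "F = A i" "G = A j" "i < t" "j < t" "i \<noteq> j" by auto
    then show "\<not> joint_copy {..<2 * ?N} (standard_example ?N) {1..n} F G"
      using non[of i j] non[of j i] by (cases "i < j") (auto simp: joint_copy_sym)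
  qed
  moreover have "inj_on A {..<t}"
  proof (rule inj_onI)
    fix i j assume "A i = A j"
    then have "card (A i) = card (A j)" by simp
    then show "i = j" unfolding A_def by simp
  qed
  then have "card (A ` {..<t}) = t" by (simp add: card_image)
  ultimately show "t \<le> independence_number ?H" using card_le_independence_number by fastforce
qed

lemma standard_example_not_chain:
  assumes "N \<ge> 2"
  shows "\<not> poset_chain {..<2 * N} (standard_example N)"
proof -
  have "0 \<in> {..<2 * N}" "1 \<in> {..<2 * N}" "(0, 1) \<notin> standard_example N" "(1, 0) \<notin> standard_example N"
    using assms by (auto simp: standard_example_def)
  then show ?thesis unfolding poset_chain_def by blast
qed

lemma standard_example_not_antichain:
  assumes "N \<ge> 2"
  shows "\<not> poset_antichain {..<2 * N} (standard_example N)"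
proof -
  have "0 \<in> {..<2 * N}" "N + 1 \<in> {..<2 * N}" "(0, N + 1) \<in> standard_example N"
    using assms by (auto simp: standard_example_def)
  then show ?thesis using assms unfolding poset_antichain_def by fastforce
qed

section \<open>The shape of independent sets\<close>

text \<open>Non-adjacent sets of the middle layers are almost equal or almost complementary. This is where
  the middle layers enter: \<open>card (F \<inter> G)\<close> and the number of elements outside \<open>F \<union> G\<close> differ by
  \<open>card F + card G - n\<close>, so if one of them is small, then both are.\<close>
lemma nonadjacent_near_or_far:
  assumes P: "finite_poset P r" "\<not> poset_chain P r" "\<not> poset_antichain P r"
    and n: "n \<ge> 8000" "n \<ge> 40 * card P"
    and FG: "F \<in> middle n" "G \<in> middle n" "\<not> joint_copy P r {1..n} F G"
  shows "F \<subseteq> G \<Longrightarrow> card (G - F) < card P"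
    and "F \<subseteq> G \<or> G \<subseteq> F \<Longrightarrow> 40 * card (sym_diff F G) \<le> n"
    and "\<not> F \<subseteq> G \<Longrightarrow> \<not> G \<subseteq> F \<Longrightarrow> 17 * n \<le> 20 * card (sym_diff F G)"
    and "\<not> F \<subseteq> G \<Longrightarrow> \<not> G \<subseteq> F \<Longrightarrow> 20 * card (F \<inter> G) \<le> 3 * n"
proof -
  have bd: "9 * n \<le> 20 * card A" "20 * card A \<le> 11 * n" "A \<subseteq> {1..n}" "finite A"
    "card ({1..n} - A) = n - card A" if "A \<in> middle n" for A
    using middle_card_bounds[OF n(1) that] middle_subset[OF that] finite_subset card_compl_interval
    by auto
  have cmp: "card (B - A) < card P" if "A \<in> middle n" "B \<in> middle n" "A \<subseteq> B"
    "\<not> joint_copy P r {1..n} A B" for A B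
  proof (rule ccontr)
    assume "\<not> ?thesis"
    moreover have "card P \<le> card A" "card P \<le> card ({1..n} - B)"
      using bd[OF that(1)] bd[OF that(2)] n by linarith+
    ultimately show False
      using joint_copy_comparable[OF P(1,3), of "{1..n}" A B] that bd by auto
  qed
  then show "F \<subseteq> G \<Longrightarrow> card (G - F) < card P" using FG by blast
  show "40 * card (sym_diff F G) \<le> n" if "F \<subseteq> G \<or> G \<subseteq> F"
  proof -
    have "sym_diff F G = G - F \<or> sym_diff F G = F - G" "F \<subseteq> G \<or> sym_diff F G = F - G"
      "G \<subseteq> F \<or> sym_diff F G = G - F" using that by blast+
    moreover have "F \<subseteq> G \<Longrightarrow> card (G - F) < card P" "G \<subseteq> F \<Longrightarrow> card (F - G) < card P"
      using cmp FG joint_copy_sym by blast+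
    ultimately have "card (sym_diff F G) < card P" using that by metis
    then show ?thesis using n by linarith
  qed
  assume inc: "\<not> F \<subseteq> G" "\<not> G \<subseteq> F"
  let ?co = "{1..n} - (F \<union> G)"
  have "card (F \<inter> G) < card P \<or> card ?co < card P"
    using joint_copy_incomparable[OF P(1,2), of "{1..n}" F G] FG inc bd by fastforce
  moreover have un: "card (F \<union> G) + card (F \<inter> G) = card F + card G"
    using card_Un_Int[of F G] bd FG by simp
  moreover have "card (F \<union> G) + card ?co = n"
  proof -
    have "F \<union> G \<subseteq> {1..n}" using bd FG by blast
    then show ?thesis
      using card_mono[of "{1..n}" "F \<union> G"] card_compl_interval[of "F \<union> G" n] by simp
  qed
  moreover have "20 * x + 20 * y \<le> 3 * n"
    if "x < card P \<or> y < card P" "u + x = f + g" "u + y = n"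
      "9 * n \<le> 20 * f" "20 * f \<le> 11 * n" "9 * n \<le> 20 * g" "20 * g \<le> 11 * n" for x y u f g
  proof -
    have "y + f + g = n + x" using that by linarith
    then have "20 * y \<le> 2 * n + 20 * x" "20 * x \<le> 2 * n + 20 * y" using that by linarith+
    moreover have "40 * x \<le> n \<or> 40 * y \<le> n" using that(1) n(2) by linarith
    ultimately show ?thesis by (elim disjE) simp_all
  qed
  ultimately have small: "20 * card (F \<inter> G) + 20 * card ?co \<le> 3 * n"
    using bd(1,2)[OF FG(1)] bd(1,2)[OF FG(2)] by blast
  then show "20 * card (F \<inter> G) \<le> 3 * n" by simp
  have "card (sym_diff F G) + card (F \<inter> G) = card (F \<union> G)"
  proof -
    have "F \<union> G = sym_diff F G \<union> (F \<inter> G)" "sym_diff F G \<inter> (F \<inter> G) = {}" by blast+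
    then show ?thesis using card_Un_disjoint[of "sym_diff F G" "F \<inter> G"] bd FG by simp
  qed
  then show "17 * n \<le> 20 * card (sym_diff F G)"
    using small \<open>card (F \<union> G) + card ?co = n\<close> by linarith
qed

lemma card_sym_diff_triangle:
  assumes "finite F" "finite G" "finite H"
  shows "card (sym_diff F H) \<le> card (sym_diff F G) + card (sym_diff G H)"
proof -
  have "card (sym_diff F H) \<le> card (sym_diff F G \<union> sym_diff G H)"
    using assms by (intro card_mono) auto
  then show ?thesis using card_Un_le[of "sym_diff F G" "sym_diff G H"] by linarith
qed

text \<open>The transfer principle in the two situations in which it is used: nested pairs with a
  given size difference, and pairs that are complementary up to few elements.\<close>
lemma joint_copy_transfer_nested:
  assumes P: "finite_poset P r" and n: "n \<ge> 8000" "n \<ge> 40 * 2 ^ card P"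
    and mid: "U \<in> middle n" "V \<in> middle n" "A \<in> middle n" "B \<in> middle n"
    and sub: "U \<subset> V" "A \<subset> B" and size: "card (V - U) \<le> card (B - A)"
    and jc: "joint_copy P r {1..n} U V"
  shows "joint_copy P r {1..n} A B"
proof (rule joint_copy_transfer[OF P jc])
  have bd: "2 ^ card P \<le> card K" "2 ^ card P \<le> card ({1..n} - K)" "K \<subseteq> {1..n}" if "K \<in> middle n" for K
    using middle_card_bounds[OF n(1) that] middle_subset[OF that] card_compl_interval n by auto
  have cells: "cell {1..n} K L True True = K" "cell {1..n} K L False True = L - K"
    "cell {1..n} K L False False = {1..n} - L" "cell {1..n} K L True False = {}"
    if "K \<subset> L" "L \<subseteq> {1..n}" for K L
    using that unfolding cell_def by auto
  note cU = cells[OF sub(1) bd(3)[OF mid(2)]] and cA = cells[OF sub(2) bd(3)[OF mid(4)]]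
  show "A \<subseteq> {1..n}" "B \<subseteq> {1..n}" using bd mid by auto
  show "min (card (cell {1..n} U V b c)) (2 ^ card P) \<le> card (cell {1..n} A B b c)" for b c
    using size bd(1)[OF mid(3)] bd(2)[OF mid(4)]
    by (cases b; cases c) (simp_all del: One_nat_def add: cU cA min_le_iff_disj)
  show "cell {1..n} A B True False = {}" by (rule cA)
  show "cell {1..n} A B False True = {}" if "cell {1..n} U V False True = {}"
    using that sub(1) unfolding cU by blast
qed simp_all

lemma joint_copy_transfer_complementary:
  assumes P: "finite_poset P r" and n: "n \<ge> 8000" "n \<ge> 40 * 2 ^ card P"
    and mid: "U \<in> middle n" "V \<in> middle n" "F \<in> middle n" "G \<in> middle n"
    and nested: "U \<subseteq> V \<or> V \<subseteq> U" and small: "20 * card (F \<inter> G) \<le> 3 * n"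
    and size: "card (U - V) \<le> card (F \<inter> G)" "card (V - U) \<le> card ({1..n} - (F \<union> G))"
    and jc: "joint_copy P r {1..n} U ({1..n} - V)"
  shows "joint_copy P r {1..n} F G"
proof (rule joint_copy_transfer[OF P jc])
  let ?X = "{1..n}"
  have bd: "9 * n \<le> 20 * card K" "20 * card K \<le> 11 * n" "K \<subseteq> {1..n}" "finite K" if "K \<in> middle n" for K
    using middle_card_bounds[OF n(1) that] middle_subset[OF that] finite_subset by auto
  have cU: "cell ?X U (?X - V) True True = U - V" "cell ?X U (?X - V) False False = V - U"
    using bd(3)[OF mid(1)] bd(3)[OF mid(2)] unfolding cell_def by auto
  have cF: "cell ?X F G True True = F \<inter> G" "cell ?X F G False False = ?X - (F \<union> G)"
    "cell ?X F G True False = F - G" "cell ?X F G False True = G - F"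
    using bd(3)[OF mid(3)] bd(3)[OF mid(4)] unfolding cell_def by auto
  show "F \<subseteq> ?X" "G \<subseteq> ?X" using bd mid by auto
  have "card F = card (F \<inter> G) + card (F - G)" "card G = card (F \<inter> G) + card (G - F)"
    using card_Int_Diff[of F G] card_Int_Diff[of G F] bd mid by (simp_all add: Int_commute)
  then have diffs: "2 ^ card P \<le> card (F - G)" "2 ^ card P \<le> card (G - F)"
    using bd(1)[OF mid(3)] bd(1)[OF mid(4)] small n by linarith+
  show "min (card (cell ?X U (?X - V) b c)) (2 ^ card P) \<le> card (cell ?X F G b c)" for b c
    using size diffs by (cases b; cases c) (simp_all del: One_nat_def add: cU cF min_le_iff_disj)
  have "U \<noteq> {}" "V \<noteq> {}" "U \<noteq> ?X" "V \<noteq> ?X"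
    using bd(1,2)[OF mid(1)] bd(1,2)[OF mid(2)] n(1) by auto
  then have "cell ?X U (?X - V) True False \<noteq> {}" "cell ?X U (?X - V) False True \<noteq> {}"
    using nested bd(3)[OF mid(1)] bd(3)[OF mid(2)] unfolding cell_def by blast+
  then show "cell ?X U (?X - V) True False = {} \<Longrightarrow> cell ?X F G True False = {}"
    "cell ?X U (?X - V) False True = {} \<Longrightarrow> cell ?X F G False True = {}" by blast+
qed simp_all

text \<open>The normal form of an independent set: \<open>c1\<close> consecutive members of a chain
  together with the complements of \<open>c2\<close> consecutive members of the same chain, the second block
  being shifted by \<open>d\<close> against the first. Every such choice in every chain of the middle layers has to
  be independent. The two bounds on the sizes are the extreme differences between a block
  starting at size \<open>a\<close> and one starting at size \<open>a + d\<close>.\<close>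
definition window_shape :: "'a set \<Rightarrow> 'a rel \<Rightarrow> nat \<Rightarrow> nat \<Rightarrow> nat \<Rightarrow> int \<Rightarrow> bool" where
  "window_shape P r n c1 c2 d \<longleftrightarrow>
     (\<forall>U\<in>middle n. \<forall>V\<in>middle n. U \<subset> V \<longrightarrow> card V < card U + max c1 c2 \<longrightarrow>
        \<not> joint_copy P r {1..n} U V) \<and>
     (c1 > 0 \<longrightarrow> c2 > 0 \<longrightarrow> (\<forall>U\<in>middle n. \<forall>V\<in>middle n. (U \<subseteq> V \<or> V \<subseteq> U) \<longrightarrow>
        int (card U) - int (card V) \<le> int c1 - 1 - d \<longrightarrow>
        int (card V) - int (card U) \<le> int c2 - 1 + d \<longrightarrow>
        \<not> joint_copy P r {1..n} U ({1..n} - V)))"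

text \<open>A largest independent set splits into a chain of nearly equal sets and a chain of sets nearly
  complementary to those. By the transfer principle only the extreme members of the two chains
  matter: all intermediate sizes may be filled in, which gives the two blocks. If all sizes of one
  block lie strictly beyond those of the other, then the blocks are moved towards each other until they
  touch; this only makes the small cells smaller, and it bounds the shift.\<close>
lemma exists_window_shape:
  assumes P: "finite_poset P r" "\<not> poset_chain P r" "\<not> poset_antichain P r"
    and n: "n \<ge> 8000" "n \<ge> 40 * 2 ^ card P" and M: "middle n \<noteq> {}"
  shows "\<exists>c1 c2 d. window_shape P r n c1 c2 d \<and> 0 < c1 + c2 \<and> c1 \<le> card P \<and> c2 \<le> card P \<and>
    \<bar>d\<bar> \<le> int (card P) \<and>
    independence_number (induced (copy_graph P r n) (middle n)) \<le> c1 + c2"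
proof -
  let ?H = "induced (copy_graph P r n) (middle n)"
  let ?jc = "joint_copy P r {1..n}"
  note indep = independent_in_middle_iff[OF P(1)]
  have fP: "finite P" using finite_posetD(1)[OF P(1)] .
  have "P \<noteq> {}" using P(2) unfolding poset_chain_def by blast
  then have P1: "card P \<ge> 1" using fP by (simp add: Suc_le_eq card_gt_0_iff)
  have "card P < 2 ^ card P" by (rule less_exp)
  then have n': "n \<ge> 40 * card P" using n(2) by linarith
  note nf = nonadjacent_near_or_far[OF P n(1) n']
  have fin: "finite A" "A \<subseteq> {1..n}" if "A \<in> middle n" for A
    using middle_subset[OF that] finite_subset by auto
  obtain I where "independent_in ?H I" and I: "card I = independence_number ?H"
    using independence_number_attained by blast
  then have IM: "I \<subseteq> middle n" and non: "\<And>F G. F \<in> I \<Longrightarrow> G \<in> I \<Longrightarrow> F \<noteq> G \<Longrightarrow> \<not> ?jc F G"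
    unfolding indep by auto
  have fI: "finite I" using IM finite_middle finite_subset by blast
  have "I \<noteq> {}"
  proof
    assume "I = {}"
    obtain F where "F \<in> middle n" using M by blast
    then have "independent_in ?H {F}" unfolding indep by simp
    then show False using card_le_independence_number I \<open>I = {}\<close> by fastforce
  qed
  then obtain F0 where F0: "F0 \<in> I" by blast
  define near where "near F G \<longleftrightarrow> F \<subseteq> G \<or> G \<subseteq> F" for F G :: "nat set"
  have nearD: "40 * card (sym_diff F G) \<le> n" if "F \<in> I" "G \<in> I" "near F G" for F G
    using nf(2)[of F G] non[of F G] that IM unfolding near_def by (cases "F = G") auto
  have farD: "17 * n \<le> 20 * card (sym_diff F G)" if "F \<in> I" "G \<in> I" "\<not> near F G" for F G
    using nf(3)[of F G] non[of F G] that IM unfolding near_def by (cases "F = G") auto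
  have tri: "card (sym_diff F H) \<le> card (sym_diff F G) + card (sym_diff G H)"
    if "F \<in> I" "G \<in> I" "H \<in> I" for F G H
    using that IM fin by (intro card_sym_diff_triangle) auto
  have comm: "card (sym_diff F G) = card (sym_diff G F)" for F G :: "nat set"
    by (simp add: Un_commute)
  define C1 where "C1 = {K \<in> I. near F0 K}"
  define C2 where "C2 = I - C1"
  have C1: "near A B" if "A \<in> C1" "B \<in> C1" for A B
  proof (rule ccontr)
    assume "\<not> near A B"
    then show False using farD[of A B] nearD[of F0 A] nearD[of F0 B] tri[of A F0 B] comm[of A F0]
        that F0 n(1) unfolding C1_def by auto
  qed
  have C2: "near A B" if "A \<in> C2" "B \<in> C2" for A B
  proof (rule ccontr)
    assume "\<not> near A B"
    \<comment> \<open>three pairwise far sets: each ground element lies in at most two of the three differences\<close>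
    have "17 * n \<le> 20 * card (sym_diff A B)" "17 * n \<le> 20 * card (sym_diff F0 A)"
      "17 * n \<le> 20 * card (sym_diff F0 B)"
      using farD \<open>\<not> near A B\<close> that F0 unfolding C1_def C2_def by auto
    moreover have "card (sym_diff F0 A) + card (sym_diff F0 B) + card (sym_diff A B) \<le> 2 * n"
    proof -
      let ?S = "sym_diff F0 A" and ?T = "sym_diff F0 B" and ?W = "sym_diff A B"
      have X: "F0 \<subseteq> {1..n}" "A \<subseteq> {1..n}" "B \<subseteq> {1..n}"
        using that F0 IM fin unfolding C2_def by auto
      then have "finite F0" "finite A" "finite B"
        using finite_subset[OF _ finite_atLeastAtMost] by auto
      then have f: "finite ?S" "finite ?T" "finite ?W" by auto
      have "card ?S + card ?T = card (?S \<union> ?T) + card (?S \<inter> ?T)" using card_Un_Int[OF f(1,2)] .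
      moreover have "card (?S \<union> ?T) \<le> n" using X card_mono[of "{1..n}" "?S \<union> ?T"] by fastforce
      moreover have "card (?S \<inter> ?T) + card ?W \<le> n"
      proof -
        have "?S \<inter> ?T \<inter> ?W = {}" by blast
        then have "card (?S \<inter> ?T) + card ?W = card (?S \<inter> ?T \<union> ?W)"
          using f by (intro card_Un_disjoint[symmetric]) auto
        moreover have "?S \<inter> ?T \<union> ?W \<subseteq> {1..n}" using X by blast
        ultimately show ?thesis using card_mono[of "{1..n}" "?S \<inter> ?T \<union> ?W"] by simp
      qed
      ultimately show ?thesis by linarith
    qed
    ultimately show False using n(1) by linarith
  qed
  have cross: "\<not> near A B" if "A \<in> C1" "B \<in> C2" for A B
  proof
    assume "near A B"
    then show False using farD[of F0 B] nearD[of F0 A] nearD[of A B] tri[of F0 A B]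
        that F0 n(1) unfolding C1_def C2_def by auto
  qed
  have sub: "C1 \<subseteq> I" "C2 \<subseteq> I" and I_card: "card I = card C1 + card C2"
  proof -
    show "C1 \<subseteq> I" "C2 \<subseteq> I" unfolding C1_def C2_def by auto
    then have "I = C1 \<union> C2" "C1 \<inter> C2 = {}" unfolding C2_def by auto
    then show "card I = card C1 + card C2"
      using card_Un_disjoint[of C1 C2] fI finite_subset by auto
  qed
  have ex: "\<exists>A\<in>C. \<exists>B\<in>C. A \<subseteq> B \<and> card C \<le> card B - card A + 1"
    if "C \<subseteq> I" "C \<noteq> {}" "\<And>A B. A \<in> C \<Longrightarrow> B \<in> C \<Longrightarrow> near A B" for C
    using that IM fin(1) finite_subset[OF that(1) fI] by (intro chain_extremes) (auto simp: near_def)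
  have short: "card B - card A < card P" if "A \<in> I" "B \<in> I" "A \<subseteq> B" for A B
  proof (cases "A = B")
    case False
    then show ?thesis using nf(1)[of A B] non that IM fin card_Diff_subset[of A B] by auto
  qed (use P1 in auto)
  have nested: "\<not> ?jc U V" if "A \<in> I" "B \<in> I" "A \<subseteq> B" "U \<in> middle n" "V \<in> middle n" "U \<subset> V"
    "card V - card U \<le> card B - card A" for A B U V
  proof -
    have "card U < card V" using that fin by (intro psubset_card_mono) auto
    then have "A \<noteq> B" using that(7) by auto
    moreover have "card (V - U) \<le> card (B - A)"
      using that IM fin card_Diff_subset[of A B] card_Diff_subset[of U V] by auto
    ultimately show ?thesis
      using joint_copy_transfer_nested[OF P(1) n, of U V A B] non[of A B] that IM by auto
  qed
  have compl: "\<not> ?jc U ({1..n} - V)"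
    if FG: "F \<in> C1" "G \<in> C2" and UV: "U \<in> middle n" "V \<in> middle n" "U \<subseteq> V \<or> V \<subseteq> U"
      and size: "card V \<le> card U \<and> card U + n \<le> card V + card F + card G \<or>
        card U \<le> card V \<and> card V + card F + card G \<le> card U + n" for F G U V
  proof -
    have I': "F \<in> I" "G \<in> I" and far: "\<not> near F G" "F \<noteq> G"
      using FG sub cross near_def by auto
    then have m: "F \<in> middle n" "G \<in> middle n" and "\<not> ?jc F G" using IM non by auto
    have un: "card (F \<union> G) + card (F \<inter> G) = card F + card G"
      using card_Un_Int[of F G] fin m by simp
    have FGX: "F \<union> G \<subseteq> {1..n}" using fin m by blast
    then have co: "card ({1..n} - (F \<union> G)) = n - card (F \<union> G)" by (rule card_compl_interval)
    have le: "card (F \<union> G) \<le> n" using card_mono[OF _ FGX] by simp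
    have d: "card (U - V) = card U - card V \<and> card (V - U) = card V - card U"
    proof (cases "U \<subseteq> V")
      case True
      then have "U - V = {}" "card U \<le> card V" using fin UV by (auto intro: card_mono)
      then show ?thesis using card_Diff_subset[of U V] True fin UV by simp
    next
      case False
      then have "V - U = {}" "card V \<le> card U" using fin UV by (auto intro: card_mono)
      then show ?thesis using card_Diff_subset[of V U] False fin UV by auto
    qed
    have "card (U - V) \<le> card (F \<inter> G)" "card (V - U) \<le> card ({1..n} - (F \<union> G))"
      using size un co le d by linarith+
    moreover have "20 * card (F \<inter> G) \<le> 3 * n"
      using nf(4)[OF m \<open>\<not> ?jc F G\<close>] far unfolding near_def by blast
    ultimately show ?thesis
      using joint_copy_transfer_complementary[OF P(1) n UV(1,2) m UV(3)] \<open>\<not> ?jc F G\<close> by blast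
  qed
  have "F0 \<in> C1" using F0 unfolding C1_def near_def by blast
  then obtain A1 B1 where AB1: "A1 \<in> C1" "B1 \<in> C1" "A1 \<subseteq> B1" "card C1 \<le> card B1 - card A1 + 1"
    using ex[OF sub(1)] C1 by blast
  have le1: "card A1 \<le> card B1" using AB1 sub IM fin by (intro card_mono) auto
  define c1 where "c1 = card B1 - card A1 + 1"
  have c1: "c1 \<le> card P" "0 < c1" using short[of A1 B1] AB1(1-3) sub unfolding c1_def by (auto simp: Suc_le_eq)
  show ?thesis
  proof (cases "C2 = {}")
    case True
    have "window_shape P r n c1 0 0"
      unfolding window_shape_def
    proof (intro conjI ballI impI)
      fix U V assume UV: "U \<in> middle n" "V \<in> middle n" "U \<subset> V" "card V < card U + max c1 0"
      then have "card V - card U \<le> card B1 - card A1" unfolding c1_def by simp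
      moreover have "A1 \<in> I" "B1 \<in> I" using AB1 sub by auto
      ultimately show "\<not> ?jc U V" using nested AB1(3) UV(1-3) by simp
    qed auto
    then show ?thesis
      using c1 AB1(4) I I_card True by (intro exI[of _ c1] exI[of _ 0]) (auto simp: c1_def)
  next
    case False
    then obtain A2 B2 where AB2: "A2 \<in> C2" "B2 \<in> C2" "A2 \<subseteq> B2" "card C2 \<le> card B2 - card A2 + 1"
      using ex[OF sub(2)] C2 by blast
    have le2: "card A2 \<le> card B2" using AB2 sub IM fin by (intro card_mono) auto
    define c2 where "c2 = card B2 - card A2 + 1"
    have c2: "c2 \<le> card P" "0 < c2" using short[of A2 B2] AB2(1-3) sub unfolding c2_def by (auto simp: Suc_le_eq)
    define s' t' :: int where "s' = int (card B1) + int (card B2) - int n"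
      and "t' = int n - int (card A1) - int (card A2)"
    have sum: "s' + t' = int c1 + int c2 - 2" unfolding s'_def t'_def c1_def c2_def using le1 le2 by simp
    define s where "s = (if s' < 0 then 0 else if t' < 0 then int c1 + int c2 - 2 else s')"
    define d where "d = int c1 - 1 - s"
    have s_range: "0 \<le> s" "s \<le> int c1 + int c2 - 2"
      unfolding s_def using sum c1 c2 by auto
    have "window_shape P r n c1 c2 d"
      unfolding window_shape_def
    proof (intro conjI ballI impI)
      fix U V assume UV: "U \<in> middle n" "V \<in> middle n" "U \<subset> V" "card V < card U + max c1 c2"
      then have "card V - card U \<le> card B1 - card A1 \<or> card V - card U \<le> card B2 - card A2"
        unfolding c1_def c2_def by linarith
      moreover have "A1 \<in> I" "B1 \<in> I" "A2 \<in> I" "B2 \<in> I" using AB1 AB2 sub by auto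
      ultimately show "\<not> ?jc U V" using nested AB1(3) AB2(3) UV(1-3) by (elim disjE) simp_all
    next
      fix U V assume UV: "U \<in> middle n" "V \<in> middle n" "U \<subseteq> V \<or> V \<subseteq> U"
        and "int (card U) - int (card V) \<le> int c1 - 1 - d" "int (card V) - int (card U) \<le> int c2 - 1 + d"
      then have st: "int (card U) - int (card V) \<le> s" "int (card V) - int (card U) \<le> int c1 + int c2 - 2 - s"
        unfolding d_def by auto
      consider "card V \<le> card U" "int (card U) - int (card V) \<le> s'"
        | "card U \<le> card V" "int (card V) - int (card U) \<le> t'"
        using st sum s_range nat_le_linear[of "card V" "card U"]
        unfolding s_def by (auto split: if_splits)
      then show "\<not> ?jc U ({1..n} - V)"
      proof cases
        case 1
        then show ?thesis using compl[OF AB1(2) AB2(2) UV] unfolding s'_def by linarith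
      next
        case 2
        then show ?thesis using compl[OF AB1(1) AB2(1) UV] unfolding t'_def by linarith
      qed
    qed
    moreover have "\<bar>d\<bar> \<le> int (card P)" unfolding d_def using s_range c1 c2 by linarith
    moreover have "independence_number ?H \<le> c1 + c2"
      using I I_card AB1(4) AB2(4) unfolding c1_def c2_def by linarith
    ultimately show ?thesis using c1 c2 by (intro exI[of _ c1] exI[of _ c2] exI[of _ d]) simp
  qed
qed

section \<open>A decomposition of the cube into few saturated chains\<close>

text \<open>The least member of the chain through \<open>S\<close> in the symmetric chain decomposition of de Bruijn,
  Tengbergen and Kruyswijk on \<open>{1..m}\<close>. A chain with least member \<open>r\<close> contains one set of
  each size from \<open>card r\<close> to \<open>m - card r\<close>. On adding \<open>Suc m\<close>, the chain is prolonged by the union of its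
  top set with \<open>{Suc m}\<close>, and the other sets with \<open>Suc m\<close> adjoined form a new chain.\<close>
fun chain_root :: "nat \<Rightarrow> nat set \<Rightarrow> nat set" where
  "chain_root 0 S = {}"
| "chain_root (Suc m) S =
     (let S' = S - {Suc m}; r = chain_root m S'
      in if Suc m \<in> S \<and> card S' < m - card r then insert (Suc m) r else r)"

lemma chain_root_bounds:
  assumes "S \<subseteq> {1..m}"
  shows "chain_root m S \<subseteq> {1..m} \<and> card (chain_root m S) \<le> card S \<and> card S + card (chain_root m S) \<le> m"
  using assms
proof (induction m arbitrary: S)
  case 0
  then show ?case by simp
next
  case (Suc m)
  let ?S = "S - {Suc m}"
  let ?r = "chain_root m ?S"
  have "?S \<subseteq> {1..m}" using Suc.prems by (auto simp: le_Suc_eq)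
  note IH = Suc.IH[OF this]
  then have fin: "finite ?r" "Suc m \<notin> ?r" using finite_subset by auto
  have fS: "finite S" using Suc.prems finite_subset by blast
  show ?case
  proof (cases "Suc m \<in> S")
    case True
    then have "card S = Suc (card ?S)" using card.remove[OF fS True] by simp
    then show ?thesis using IH fin True by (auto simp: Let_def)
  next
    case False
    then show ?thesis using IH by (auto simp: Let_def)
  qed
qed

lemma chain_root_comparable:
  assumes "S \<subseteq> {1..m}" "T \<subseteq> {1..m}" "chain_root m S = chain_root m T"
  shows "S \<subseteq> T \<or> T \<subseteq> S"
  using assms
proof (induction m arbitrary: S T)
  case 0
  then show ?case by simp
next
  case (Suc m)
  let ?S = "S - {Suc m}" and ?T = "T - {Suc m}"
  let ?r = "chain_root m ?S" and ?q = "chain_root m ?T"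
  have sub: "?S \<subseteq> {1..m}" "?T \<subseteq> {1..m}" using Suc.prems by (auto simp: le_Suc_eq)
  note bS = chain_root_bounds[OF sub(1)] and bT = chain_root_bounds[OF sub(2)]
  have fin: "finite ?S" "finite ?T" using sub finite_subset[OF _ finite_atLeastAtMost] by blast+
  have notin: "Suc m \<notin> ?r" "Suc m \<notin> ?q" using bS bT by auto
  define p where "p \<longleftrightarrow> Suc m \<in> S \<and> card ?S < m - card ?r"
  define p' where "p' \<longleftrightarrow> Suc m \<in> T \<and> card ?T < m - card ?q"
  have eq: "(if p then insert (Suc m) ?r else ?r) = (if p' then insert (Suc m) ?q else ?q)"
    using Suc.prems(3) unfolding p_def p'_def by (simp add: Let_def)
  then have pp: "p = p'" using notin by (auto split: if_splits)
  then have rq: "?r = ?q" using eq notin insert_ident[OF notin] by (simp split: if_splits)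
  have cmp: "?S \<subseteq> ?T \<or> ?T \<subseteq> ?S" using Suc.IH[OF sub rq] .
  show ?case
  proof (cases "Suc m \<in> S \<longleftrightarrow> Suc m \<in> T")
    case True
    then show ?thesis using cmp by blast
  next
    case False
    \<comment> \<open>the one of the two sets that contains \<open>Suc m\<close> comes from the top of the old chain\<close>
    then consider "Suc m \<notin> S" "Suc m \<in> T" "card ?S \<le> card ?T"
      | "Suc m \<notin> T" "Suc m \<in> S" "card ?T \<le> card ?S"
      using pp rq bS bT unfolding p_def p'_def by fastforce
    then show ?thesis
    proof cases
      case 1
      then have "?S \<subseteq> ?T" using cmp card_seteq[OF fin(1), of ?T] by blast
      then show ?thesis using 1 by blast
    next
      case 2
      then have "?T \<subseteq> ?S" using cmp card_seteq[OF fin(2), of ?S] by blast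
      then show ?thesis using 2 by blast
    qed
  qed
qed

lemma chain_root_saturated:
  assumes "S \<subseteq> {1..m}" "card (chain_root m S) \<le> k" "k + card (chain_root m S) \<le> m"
  shows "\<exists>T\<subseteq>{1..m}. chain_root m T = chain_root m S \<and> card T = k"
  using assms
proof (induction m arbitrary: S k)
  case 0
  then show ?case by auto
next
  case (Suc m)
  let ?S = "S - {Suc m}"
  let ?r = "chain_root m ?S"
  have sub: "?S \<subseteq> {1..m}" using Suc.prems by (auto simp: le_Suc_eq)
  note b = chain_root_bounds[OF sub]
  then have fin: "finite ?r" "Suc m \<notin> ?r" using finite_subset by auto
  have ins: "insert (Suc m) T \<subseteq> {1..Suc m}" "insert (Suc m) T - {Suc m} = T" "card (insert (Suc m) T) = Suc (card T)"
    "T - {Suc m} = T" "Suc m \<notin> T" "T \<subseteq> {1..Suc m}"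
    if "T \<subseteq> {1..m}" for T
  proof -
    show *: "Suc m \<notin> T" using that by auto
    show "card (insert (Suc m) T) = Suc (card T)"
      using * finite_subset[OF that] by simp
  qed (use that in auto)
  show ?case
  proof (cases "Suc m \<in> S \<and> card ?S < m - card ?r")
    case True
    then have R: "chain_root (Suc m) S = insert (Suc m) ?r"
      by (simp add: Let_def del: card_Diff_insert)
    then have k: "card ?r \<le> k - 1" "(k - 1) + card ?r \<le> m" "k - 1 < m - card ?r" "k \<ge> 1"
      using Suc.prems fin by auto
    obtain T where T: "T \<subseteq> {1..m}" "chain_root m T = ?r" "card T = k - 1"
      using Suc.IH[OF sub k(1,2)] by blast
    have "chain_root (Suc m) (insert (Suc m) T) = insert (Suc m) ?r"
      using T k ins[OF T(1)] by (simp add: Let_def)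
    then show ?thesis using R T k ins[OF T(1)] by (intro exI[of _ "insert (Suc m) T"]) simp
  next
    case False
    then have R: "chain_root (Suc m) S = ?r" by (auto simp: Let_def)
    show ?thesis
    proof (cases "k + card ?r \<le> m")
      case True
      then obtain T where T: "T \<subseteq> {1..m}" "chain_root m T = ?r" "card T = k"
        using Suc.IH[OF sub, of k] Suc.prems R by auto
      then show ?thesis using R ins[OF T(1)] by (intro exI[of _ T]) (simp add: Let_def)
    next
      case False
      then have k: "k = Suc (m - card ?r)" using Suc.prems R b by auto
      obtain T where T: "T \<subseteq> {1..m}" "chain_root m T = ?r" "card T = m - card ?r"
        using Suc.IH[OF sub, of "m - card ?r"] b by fastforce
      then have "chain_root (Suc m) (insert (Suc m) T) = ?r"
        using ins[OF T(1)] by (simp add: Let_def)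
      then show ?thesis using R T k ins[OF T(1)] by (intro exI[of _ "insert (Suc m) T"]) simp
    qed
  qed
qed

lemma card_chain_roots_le: "card (chain_root m ` Pow {1..m}) \<le> m choose (m div 2)"
proof -
  let ?L = "{T. T \<subseteq> {1..m} \<and> card T = m div 2}"
  have fin: "finite ?L" by (rule finite_subset[of _ "Pow {1..m}"]) auto
  have "chain_root m ` Pow {1..m} \<subseteq> chain_root m ` ?L"
  proof
    fix r assume "r \<in> chain_root m ` Pow {1..m}"
    then obtain S where S: "S \<subseteq> {1..m}" "r = chain_root m S" by blast
    have "card r \<le> m div 2" "m div 2 + card r \<le> m"
      using chain_root_bounds[OF S(1)] unfolding S(2) by auto
    then obtain T where "T \<subseteq> {1..m}" "chain_root m T = r" "card T = m div 2"
      using chain_root_saturated[OF S(1)] S(2) by blast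
    then show "r \<in> chain_root m ` ?L" by blast
  qed
  then have "card (chain_root m ` Pow {1..m}) \<le> card (chain_root m ` ?L)"
    using fin by (intro card_mono) auto
  also have "\<dots> \<le> card ?L" using fin by (rule card_image_le)
  also have "\<dots> = m choose (m div 2)" using n_subsets[of "{1..m}" "m div 2"] by simp
  finally show ?thesis .
qed

lemma sum_chain_lengths_le:
  "(\<Sum>r\<in>chain_root m ` Pow {1..m}. Suc m - 2 * card r) \<le> 2 ^ m"
proof -
  let ?R = "chain_root m ` Pow {1..m}"
  let ?D = "SIGMA r:?R. {card r..m - card r}"
  have "?D \<subseteq> (\<lambda>T. (chain_root m T, card T)) ` Pow {1..m}"
  proof
    fix z assume "z \<in> ?D"
    then obtain r k where rk: "z = (r, k)" "r \<in> ?R" "k \<in> {card r..m - card r}" by (rule SigmaE)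
    from rk(2) obtain S where S: "r = chain_root m S" "S \<subseteq> {1..m}" by (elim imageE PowD) simp
    have "card (chain_root m S) \<le> k" "k + card (chain_root m S) \<le> m"
      using rk(3) chain_root_bounds[OF S(2)] unfolding S(1) by auto
    from chain_root_saturated[OF S(2) this]
    obtain T where "T \<subseteq> {1..m}" "chain_root m T = chain_root m S" "card T = k" by (elim exE conjE)
    then show "z \<in> (\<lambda>T. (chain_root m T, card T)) ` Pow {1..m}"
      using rk(1) S(1) by (intro image_eqI[of _ _ T]) auto
  qed
  then have "card ?D \<le> card ((\<lambda>T. (chain_root m T, card T)) ` Pow {1..m})" by (rule card_mono[rotated]) simp
  also have "\<dots> \<le> card (Pow {1..m})" by (rule card_image_le) simp
  finally have "card ?D \<le> card (Pow {1..m})" .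
  moreover have "card ?D = (\<Sum>r\<in>?R. card {card r..m - card r})" by (rule card_SigmaI) auto
  moreover have "(\<Sum>r\<in>?R. card {card r..m - card r}) = (\<Sum>r\<in>?R. Suc m - 2 * card r)"
  proof (rule sum.cong)
    fix r assume "r \<in> ?R"
    then obtain S where S: "S \<subseteq> {1..m}" "r = chain_root m S" by blast
    have "2 * card r \<le> m" using chain_root_bounds[OF S(1)] unfolding S(2) by linarith
    then show "card {card r..m - card r} = Suc m - 2 * card r" by simp
  qed simp
  ultimately show ?thesis by (simp add: card_Pow)
qed

section \<open>The colouring problem\<close>

text \<open>A family of \<open>2 ^ n\<close> subsets of \<open>{1..n}\<close> is the whole power set, so the parameter is the chromatic
  number of the copy graph.\<close>
lemma ar_star_m_le_card_colours:
  fixes col :: "nat set \<Rightarrow> 'c"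
  assumes P: "finite_poset P r"
    and proper: "\<And>S T. S \<subseteq> {1..n} \<Longrightarrow> T \<subseteq> {1..n} \<Longrightarrow> S \<noteq> T \<Longrightarrow> joint_copy P r {1..n} S T \<Longrightarrow> col S \<noteq> col T"
  shows "ar_star_m n (2 ^ n) P r \<le> card (col ` Pow {1..n})"
proof -
  let ?I = "col ` Pow {1..n}"
  have "finite ?I" by simp
  then obtain h where h: "bij_betw h ?I {1..card ?I}"
    using finite_same_card_bij[of ?I "{1..card ?I}"] by auto
  have "inj_on (h \<circ> col) \<G>" if "\<G> \<subseteq> Pow {1..n}" "strong_copy P r \<G>" for \<G>
  proof (rule inj_onI, rule ccontr)
    fix S T assume ST: "S \<in> \<G>" "T \<in> \<G>" "(h \<circ> col) S = (h \<circ> col) T" "S \<noteq> T"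
    then have in': "S \<subseteq> {1..n}" "T \<subseteq> {1..n}" using that by auto
    have "joint_copy P r {1..n} S T"
      unfolding joint_copy_iff_strong_copy[OF P] using that ST by blast
    then have "col S \<noteq> col T" using proper in' ST by blast
    then show False using ST(3) bij_betw_imp_inj_on[OF h] in' by (auto dest: inj_onD)
  qed
  moreover have "(h \<circ> col) ` Pow {1..n} \<subseteq> {1..card ?I}"
    using bij_betw_imp_surj_on[OF h] by auto
  ultimately show ?thesis
    unfolding ar_star_m_def rainbow_def
    by (intro Least_le exI[of _ "Pow {1..n}"] exI[of _ "h \<circ> col"]) (auto simp: card_Pow)
qed

lemma card_middle_le_ar_star_m:
  assumes P: "finite_poset P r"
  shows "card (middle n) \<le>
    ar_star_m n (2 ^ n) P r * independence_number (induced (copy_graph P r n) (middle n))"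
proof -
  let ?H = "induced (copy_graph P r n) (middle n)"
  define Q where "Q k \<longleftrightarrow> (\<exists>\<F> c. \<F> \<subseteq> Pow {1..n} \<and> card \<F> = 2 ^ n \<and> c ` \<F> \<subseteq> {1..k} \<and>
    (\<forall>\<G>. \<G> \<subseteq> \<F> \<and> strong_copy P r \<G> \<longrightarrow> rainbow c \<G>))" for k
  obtain h where h: "bij_betw h (Pow {1..n}) {1..(2::nat) ^ n}"
    using finite_same_card_bij[of "Pow {1..n}" "{1..(2::nat) ^ n}"] by (auto simp: card_Pow)
  have "Q (2 ^ n)"
    unfolding Q_def rainbow_def using h
    by (intro exI[of _ "Pow {1..n}"] exI[of _ h]) (auto simp: card_Pow bij_betw_def intro: inj_on_subset)
  moreover have "ar_star_m n (2 ^ n) P r = (LEAST k. Q k)" unfolding ar_star_m_def Q_def ..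
  ultimately have "Q (ar_star_m n (2 ^ n) P r)" using LeastI[of Q] by simp
  then obtain \<F> c where Fc: "\<F> \<subseteq> Pow {1..n} \<and> card \<F> = 2 ^ n \<and>
    c ` \<F> \<subseteq> {1..ar_star_m n (2 ^ n) P r} \<and> (\<forall>\<G>. \<G> \<subseteq> \<F> \<and> strong_copy P r \<G> \<longrightarrow> inj_on c \<G>)"
    unfolding Q_def rainbow_def by (elim exE) (rule that)
  then have c: "\<F> \<subseteq> Pow {1..n}" "card \<F> = 2 ^ n" "c ` \<F> \<subseteq> {1..ar_star_m n (2 ^ n) P r}"
    by simp_all
  have inj: "inj_on c \<G>" if "\<G> \<subseteq> \<F>" "strong_copy P r \<G>" for \<G>
    using Fc that by simp
  have \<F>: "\<F> = Pow {1..n}" using c by (intro card_subset_eq) (auto simp: card_Pow)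
  define K where "K = {1..ar_star_m n (2 ^ n) P r}"
  have "middle n \<subseteq> (\<Union>i\<in>K. {F \<in> middle n. c F = i})"
  proof
    fix F assume F: "F \<in> middle n"
    then have "F \<in> \<F>" using middle_subset[OF F] unfolding \<F> by blast
    then have "c F \<in> K" using c(3) unfolding K_def by blast
    with F show "F \<in> (\<Union>i\<in>K. {F \<in> middle n. c F = i})" by simp
  qed
  then have "card (middle n) \<le> card (\<Union>i\<in>K. {F \<in> middle n. c F = i})"
    using finite_middle by (intro card_mono) (auto simp: K_def)
  also have "\<dots> \<le> (\<Sum>i\<in>K. card {F \<in> middle n. c F = i})"
    by (rule card_UN_le) (simp add: K_def)
  also have "\<dots> \<le> (\<Sum>i\<in>K. independence_number ?H)"
  proof (rule sum_mono)
    fix i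
    have "independent_in ?H {F \<in> middle n. c F = i}"
      unfolding independent_in_middle_iff[OF P]
    proof (intro conjI ballI impI notI)
      show "{F \<in> middle n. c F = i} \<subseteq> middle n" by simp
      fix F G assume FG: "F \<in> {F \<in> middle n. c F = i}" "G \<in> {F \<in> middle n. c F = i}" "F \<noteq> G"
        "joint_copy P r {1..n} F G"
      from FG(4) obtain \<G> where "\<G> \<subseteq> Pow {1..n}" "strong_copy P r \<G>" "F \<in> \<G>" "G \<in> \<G>"
        unfolding joint_copy_iff_strong_copy[OF P] by (elim exE conjE) (rule that)
      then show False using inj[of \<G>] FG unfolding \<F> by (auto dest: inj_onD)
    qed
    then show "card {F \<in> middle n. c F = i} \<le> independence_number ?H"
      by (rule card_le_independence_number)
  qed
  also have "\<dots> = ar_star_m n (2 ^ n) P r * independence_number ?H" by (simp add: K_def)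
  finally show ?thesis .
qed

text \<open>Each chain \<open>U\<close> of \<open>{1..m}\<close> is treated together with the chain of complements of its members in
  \<open>{1..Suc m}\<close>; these pairs partition the power set of \<open>{1..Suc m}\<close>. On the first chain, blocks of \<open>c1\<close> and
  \<open>c2\<close> consecutive sizes alternate; on the second chain, blocks of \<open>c2\<close> and \<open>c1\<close> alternate, starting at
  the shift \<open>d\<close>. A colour class consists of one block from each chain. Swapping
  \<open>c1\<close> and \<open>c2\<close> in every other class makes both chains advance by \<open>c1 + c2\<close> per period, and the
  shift between the two blocks becomes \<open>d + c2 - c1\<close>, which leaves the extreme differences of sizes unchanged.
  The third component 2 marks the sets outside the middle layers, whose colours are all distinct.\<close>
definition window_colour ::
  "nat \<Rightarrow> nat \<Rightarrow> nat \<Rightarrow> int \<Rightarrow> nat set \<Rightarrow> nat set \<times> int \<times> nat" where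
  "window_colour m c1 c2 d S =
     (let a = int (c1 + c2); k = int (card S); S' = {1..Suc m} - S; k' = int (card S') - d
      in if S \<notin> middle (Suc m) then (S, 0, 2)
         else if Suc m \<notin> S then (chain_root m S, k div a, if k mod a < int c1 then 0 else 1)
         else (chain_root m S', k' div a, if k' mod a < int c2 then 0 else 1))"

lemma window_colour_simps:
  "S \<notin> middle (Suc m) \<Longrightarrow> window_colour m c1 c2 d S = (S, 0, 2)"
  "S \<in> middle (Suc m) \<Longrightarrow> Suc m \<notin> S \<Longrightarrow> window_colour m c1 c2 d S =
     (chain_root m S, int (card S) div int (c1 + c2),
      if int (card S) mod int (c1 + c2) < int c1 then 0 else 1)"
  "S \<in> middle (Suc m) \<Longrightarrow> Suc m \<in> S \<Longrightarrow> window_colour m c1 c2 d S =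
     (chain_root m ({1..Suc m} - S), (int (card ({1..Suc m} - S)) - d) div int (c1 + c2),
      if (int (card ({1..Suc m} - S)) - d) mod int (c1 + c2) < int c2 then 0 else 1)"
  unfolding window_colour_def Let_def by simp_all

lemma window_colour_eq_two_iff:
  "snd (snd (window_colour m c1 c2 d S)) = 2 \<longleftrightarrow> S \<notin> middle (Suc m)"
  by (cases "S \<in> middle (Suc m)"; cases "Suc m \<in> S") (simp_all add: window_colour_simps)

lemma if_zero_one_eq_iff:
  "((if a then 0 else 1::nat) = (if b then 0 else 1)) = (a = b)"
  by simp

lemma same_block_close:
  fixes x y a c :: int
  assumes "0 < a" "x div a = y div a" "(x mod a < c) = (y mod a < c)"
  shows "x - y < max c (a - c)"
proof -
  have "x - y = x mod a - y mod a"
    using div_mult_mod_eq[of x a] div_mult_mod_eq[of y a] assms(2) by (metis add_diff_cancel_left)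
  then show ?thesis using pos_mod_bound[OF assms(1)] pos_mod_sign[OF assms(1)] assms(3)
    by (cases "x mod a < c") (auto simp: max_def intro: le_less_trans, (smt (verit) pos_mod_bound pos_mod_sign assms(1))+)
qed

lemma opposite_blocks_close:
  fixes x y c1 c2 :: int
  assumes "0 \<le> c1" "0 \<le> c2" "0 < c1 + c2" "x div (c1 + c2) = y div (c1 + c2)"
    "(x mod (c1 + c2) < c1) = (y mod (c1 + c2) < c2)"
  shows "0 < c1" "0 < c2" "x - y \<le> c1 - 1" "y - x \<le> c2 - 1"
proof -
  let ?a = "c1 + c2"
  have d: "x - y = x mod ?a - y mod ?a"
    using div_mult_mod_eq[of x ?a] div_mult_mod_eq[of y ?a] assms(4) by (metis add_diff_cancel_left)
  have b: "0 \<le> x mod ?a" "x mod ?a < ?a" "0 \<le> y mod ?a" "y mod ?a < ?a" using assms(3) by auto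
  show "0 < c1" "0 < c2" "x - y \<le> c1 - 1" "y - x \<le> c2 - 1"
    using d b assms(1,2,5) by (cases "x mod ?a < c1"; linarith)+
qed

lemma window_colour_proper:
  assumes P: "finite_poset P r" and w: "window_shape P r (Suc m) c1 c2 d" and c: "0 < c1 + c2"
    and ST: "S \<subseteq> {1..Suc m}" "T \<subseteq> {1..Suc m}" "S \<noteq> T" "joint_copy P r {1..Suc m} S T"
  shows "window_colour m c1 c2 d S \<noteq> window_colour m c1 c2 d T"
proof
  let ?n = "Suc m"
  let ?X = "{1..?n}"
  let ?a = "int (c1 + c2)"
  assume eq: "window_colour m c1 c2 d S = window_colour m c1 c2 d T"
  have mid: "S \<in> middle ?n" "T \<in> middle ?n"
  proof -
    have "S \<in> middle ?n \<longleftrightarrow> T \<in> middle ?n"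
      using eq window_colour_eq_two_iff by metis
    moreover have "S \<in> middle ?n \<or> T \<in> middle ?n"
      using eq ST(3) window_colour_simps(1)[of S] window_colour_simps(1)[of T] by (metis prod.inject)
    ultimately show "S \<in> middle ?n" "T \<in> middle ?n" by simp_all
  qed
  have a: "0 < ?a" using c by linarith
  have w1: "\<not> joint_copy P r ?X U V" if "U \<in> middle ?n" "V \<in> middle ?n" "U \<subset> V"
    "card V < card U + max c1 c2" for U V
    using w that unfolding window_shape_def by simp
  from w have "c1 > 0 \<longrightarrow> c2 > 0 \<longrightarrow> (\<forall>U\<in>middle ?n. \<forall>V\<in>middle ?n. (U \<subseteq> V \<or> V \<subseteq> U) \<longrightarrow>
      int (card U) - int (card V) \<le> int c1 - 1 - d \<longrightarrow> int (card V) - int (card U) \<le> int c2 - 1 + d \<longrightarrow>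
      \<not> joint_copy P r ?X U (?X - V))"
    unfolding window_shape_def by (rule conjunct2)
  note w2' = this[rule_format]
  have w2: "\<not> joint_copy P r ?X U (?X - V)" if "U \<in> middle ?n" "V \<in> middle ?n" "U \<subseteq> V \<or> V \<subseteq> U"
    "0 < c1" "0 < c2" "int (card U) - int (card V) \<le> int c1 - 1 - d"
    "int (card V) - int (card U) \<le> int c2 - 1 + d" for U V
    by (rule w2'[OF that(4,5,1,2,3,6,7)])
  have nest: "\<not> joint_copy P r ?X U V"
    if "U \<in> middle ?n" "V \<in> middle ?n" "U \<noteq> V" "U \<subseteq> V \<or> V \<subseteq> U"
      "\<bar>int (card U) - int (card V)\<bar> < int (max c1 c2)" for U V
  proof -
    have "U \<subset> V \<or> V \<subset> U" using that by blast
    moreover have "card V < card U + max c1 c2" "card U < card V + max c1 c2" using that(5) by linarith+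
    ultimately show ?thesis
      using w1[OF that(1,2)] w1[OF that(2,1)] joint_copy_sym[of P r ?X U V] by blast
  qed
  have cross: False
    if UV: "U \<subseteq> ?X" "V \<subseteq> ?X" "U \<in> middle ?n" "V \<in> middle ?n" "?n \<notin> U" "?n \<in> V"
      and e: "window_colour m c1 c2 d U = window_colour m c1 c2 d V" and jc: "joint_copy P r ?X U V" for U V
  proof -
    define W where "W = ?X - V"
    have W: "W \<in> middle ?n" "?X - W = V" "W \<subseteq> {1..m}" "U \<subseteq> {1..m}"
      using middle_compl[OF UV(4)] UV unfolding W_def by (auto simp: le_Suc_eq)
    let ?x = "int (card U)" and ?y = "int (card W) - d"
    have "chain_root m U = chain_root m W" "?x div ?a = ?y div ?a"
      "(?x mod ?a < int c1) = (?y mod ?a < int c2)"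
      using e window_colour_simps(2)[OF UV(3,5)] window_colour_simps(3)[OF UV(4,6)]
      by (simp_all only: prod.inject if_zero_one_eq_iff W_def)
    then have "U \<subseteq> W \<or> W \<subseteq> U" "0 < int c1" "0 < int c2" "?x - ?y \<le> int c1 - 1" "?y - ?x \<le> int c2 - 1"
      using chain_root_comparable[OF W(4,3)] opposite_blocks_close[of "int c1" "int c2" ?x ?y] a by auto
    then have "\<not> joint_copy P r ?X U (?X - W)"
      using w2[OF UV(3) W(1)] by simp
    then show False using jc unfolding W(2) ..
  qed
  show False
  proof (cases "?n \<in> S"; cases "?n \<in> T")
    assume n: "?n \<notin> S" "?n \<notin> T"
    then have sub: "S \<subseteq> {1..m}" "T \<subseteq> {1..m}" using ST by (auto simp: le_Suc_eq)
    let ?x = "int (card S)" and ?y = "int (card T)"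
    have e: "chain_root m S = chain_root m T" "?x div ?a = ?y div ?a"
      "(?x mod ?a < int c1) = (?y mod ?a < int c1)"
      using eq window_colour_simps(2)[OF mid(1) n(1)] window_colour_simps(2)[OF mid(2) n(2)]
      by (simp_all only: prod.inject if_zero_one_eq_iff)
    have "\<bar>?x - ?y\<bar> < int (max c1 c2)"
      using same_block_close[OF a e(2,3)] same_block_close[OF a e(2,3)[symmetric]] by linarith
    then show False using nest[OF mid ST(3)] chain_root_comparable[OF sub e(1)] ST(4) by blast
  next
    assume n: "?n \<in> S" "?n \<in> T"
    let ?S = "?X - S" and ?T = "?X - T"
    have sub: "?S \<subseteq> {1..m}" "?T \<subseteq> {1..m}" using n by (auto simp: le_Suc_eq)
    let ?x = "int (card ?S) - d" and ?y = "int (card ?T) - d"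
    have e: "chain_root m ?S = chain_root m ?T" "?x div ?a = ?y div ?a"
      "(?x mod ?a < int c2) = (?y mod ?a < int c2)"
      using eq window_colour_simps(3)[OF mid(1) n(1)] window_colour_simps(3)[OF mid(2) n(2)]
      by (simp_all only: prod.inject if_zero_one_eq_iff)
    have "\<bar>?x - ?y\<bar> < int (max c1 c2)"
      using same_block_close[OF a e(2,3)] same_block_close[OF a e(2,3)[symmetric]] by linarith
    moreover have "int (card ?S) = int ?n - int (card S)" "int (card ?T) = int ?n - int (card T)"
      using card_compl_interval[OF ST(1)] card_compl_interval[OF ST(2)]
        card_mono[OF finite_atLeastAtMost ST(1)] card_mono[OF finite_atLeastAtMost ST(2)] by auto
    ultimately have "\<bar>int (card S) - int (card T)\<bar> < int (max c1 c2)" by linarith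
    moreover have "S \<subseteq> T \<or> T \<subseteq> S" using chain_root_comparable[OF sub e(1)] ST(1,2) by blast
    ultimately show False using nest[OF mid ST(3)] ST(4) by blast
  next
    assume "?n \<notin> S" "?n \<in> T"
    then show False by (rule cross[OF ST(1,2) mid _ _ eq ST(4)])
  next
    assume "?n \<in> S" "?n \<notin> T"
    then show False
      using cross[OF ST(2,1) mid(2,1) _ _ eq[symmetric]] ST(4) joint_copy_sym[of P r ?X S T] by simp
  qed
qed

lemma card_div_range_le:
  fixes x y a :: int
  assumes "0 < a" "x \<le> y"
  shows "real (card {x div a..y div a}) \<le> (y - x) / a + 2"
proof -
  have "real (card {x div a..y div a}) = real_of_int (y div a - x div a + 1)"
    using zdiv_mono1[OF assms(2,1)] by simp
  also have "\<dots> \<le> y / a - x / a + 2"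
  proof -
    have "real_of_int (y div a) \<le> y / a" by (rule real_of_int_div4)
    moreover have "x / a - real_of_int (x div a) \<le> 1" by (rule real_of_int_div3)
    ultimately show ?thesis by simp
  qed
  finally show ?thesis by (simp add: diff_divide_distrib)
qed

text \<open>Every chain contributes about twice its length divided by \<open>c1 + c2\<close>, up to a bounded
  error for its two ends and for the shift. The lengths add up to at most \<open>2 ^ m\<close>, and the number
  of chains is at most the number of sets of size \<open>m div 2\<close>.\<close>
lemma card_window_colours_le:
  assumes c: "0 < c1 + c2" and d: "\<bar>d\<bar> \<le> int D"
  shows "real (card (window_colour m c1 c2 d ` Pow {1..Suc m})) \<le>
    2 ^ Suc m / real (c1 + c2) + (4 * real D + 4) * real (m choose (m div 2))
      + real (card (Pow {1..Suc m} - middle (Suc m)))"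
proof -
  let ?n = "Suc m"
  let ?X = "{1..?n}"
  let ?a = "int (c1 + c2)"
  let ?R = "chain_root m ` Pow {1..m}"
  define H where "H r = {(int (card r) - int D) div ?a..(int m - int (card r) + int D) div ?a}" for r :: "nat set"
  define Out where "Out = (\<lambda>S. (S, 0::int, 2::nat)) ` (Pow ?X - middle ?n)"
  define In where "In = (SIGMA r:?R. H r \<times> {0, 1::nat})"
  have a: "0 < ?a" using c by linarith
  have fin: "finite Out" "finite In" unfolding Out_def In_def H_def by auto
  have key: "(chain_root m U, k div ?a, f) \<in> In"
    if U: "U \<subseteq> {1..m}" "\<bar>k - int (card U)\<bar> \<le> int D" "f \<in> {0, 1}" for U k f
  proof -
    have "int (card (chain_root m U)) - int D \<le> k" "k \<le> int m - int (card (chain_root m U)) + int D"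
      using chain_root_bounds[OF U(1)] U(2) by linarith+
    then have "k div ?a \<in> H (chain_root m U)" unfolding H_def using a by (auto intro: zdiv_mono1)
    then show ?thesis unfolding In_def using U by auto
  qed
  have "window_colour m c1 c2 d S \<in> Out \<union> In" if S: "S \<subseteq> ?X" for S
  proof (cases "S \<in> middle ?n")
    case False
    then show ?thesis using S unfolding window_colour_def Out_def by auto
  next
    case True
    show ?thesis
    proof (cases "?n \<in> S")
      case False
      then have "S \<subseteq> {1..m}" using S by (auto simp: le_Suc_eq)
      then show ?thesis
        using key[of S "int (card S)"] True False unfolding window_colour_def by (simp add: Let_def)
    next
      case n: True
      then have "?X - S \<subseteq> {1..m}" by (auto simp: le_Suc_eq)
      then show ?thesis
        using key[of "?X - S" "int (card (?X - S)) - d"] True n d unfolding window_colour_def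
        by (simp add: Let_def)
    qed
  qed
  then have "card (window_colour m c1 c2 d ` Pow ?X) \<le> card (Out \<union> In)"
    using fin by (intro card_mono image_subsetI) simp_all
  also have "\<dots> \<le> card Out + card In" by (rule card_Un_le)
  finally have le: "card (window_colour m c1 c2 d ` Pow ?X) \<le> card Out + card In" .
  have out: "card Out \<le> card (Pow ?X - middle ?n)" unfolding Out_def by (rule card_image_le) simp
  have len: "real (card (H r)) \<le> real (Suc m - 2 * card r) / real (c1 + c2) + (2 * real D + 2)"
    if r: "r \<in> ?R" for r
  proof -
    obtain S where S: "S \<subseteq> {1..m}" "r = chain_root m S" using r by blast
    have r2: "2 * card r \<le> m" using chain_root_bounds[OF S(1)] unfolding S(2) by linarith
    have "real (card (H r)) \<le>
      ((int m - int (card r) + int D) - (int (card r) - int D)) / real_of_int ?a + 2"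
      unfolding H_def using r2 by (intro card_div_range_le[OF a]) linarith
    also have "\<dots> = (real m - 2 * real (card r)) / real (c1 + c2) + 2 * real D / real (c1 + c2) + 2"
      by (simp add: add_divide_distrib diff_divide_distrib)
    also have "\<dots> \<le> real (Suc m - 2 * card r) / real (c1 + c2) + 2 * real D + 2"
    proof (intro add_mono)
      show "(real m - 2 * real (card r)) / real (c1 + c2) \<le> real (Suc m - 2 * card r) / real (c1 + c2)"
        using r2 by (intro divide_right_mono) (auto simp: of_nat_diff)
      have "1 \<le> real (c1 + c2)" using c by linarith
      then show "2 * real D / real (c1 + c2) \<le> 2 * real D"
        using mult_left_mono[of 1 "real (c1 + c2)" "2 * real D"] by (simp add: divide_le_eq)
    qed simp
    finally show ?thesis by simp
  qed
  have "card In = (\<Sum>r\<in>?R. card (H r \<times> {0, 1::nat}))"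
    unfolding In_def by (rule card_SigmaI) (auto simp: H_def)
  then have "real (card In) = 2 * (\<Sum>r\<in>?R. real (card (H r)))"
    by (simp add: card_cartesian_product sum_distrib_left mult.commute)
  also have "\<dots> \<le> 2 * (\<Sum>r\<in>?R. real (Suc m - 2 * card r) / real (c1 + c2) + (2 * real D + 2))"
    using len by (intro mult_left_mono sum_mono) auto
  also have "\<dots> = 2 * (real (\<Sum>r\<in>?R. Suc m - 2 * card r) / real (c1 + c2) + real (card ?R) * (2 * real D + 2))"
    by (simp add: sum.distrib sum_divide_distrib)
  also have "\<dots> \<le> 2 * (2 ^ m / real (c1 + c2) + real (m choose (m div 2)) * (2 * real D + 2))"
  proof (intro mult_left_mono add_mono divide_right_mono mult_right_mono)
    show "real (\<Sum>r\<in>?R. Suc m - 2 * card r) \<le> 2 ^ m"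
      using of_nat_mono[OF sum_chain_lengths_le[of m], where 'a = real] by simp
    show "real (card ?R) \<le> real (m choose (m div 2))" using card_chain_roots_le by simp
  qed auto
  also have "\<dots> = 2 ^ Suc m / real (c1 + c2) + (4 * real D + 4) * real (m choose (m div 2))"
    by (simp add: field_simps)
  finally show ?thesis using le out by linarith
qed

section \<open>Asymptotics\<close>

lemma central_binomial_Suc:
  "(k + 1) * ((2 * k + 2) choose (k + 1)) = 2 * (2 * k + 1) * ((2 * k) choose k)"
proof -
  have "(k + 1) * ((2 * k + 2) choose (k + 1)) = (2 * k + 2) * ((2 * k + 1) choose k)"
    using Suc_times_binomial_eq[of "2 * k + 1" k] by (simp add: mult.commute)
  also have "(2 * k + 1) choose k = (2 * k + 1) choose (k + 1)"
    using binomial_symmetric[of k "2 * k + 1"] by simp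
  also have "(2 * k + 2) * \<dots> = 2 * ((k + 1) * ((2 * k + 1) choose (k + 1)))" by simp
  also have "(k + 1) * ((2 * k + 1) choose (k + 1)) = (2 * k + 1) * ((2 * k) choose k)"
    using Suc_times_binomial_eq[of "2 * k" k] by (simp add: mult.commute)
  finally show ?thesis by simp
qed

text \<open>The factor \<open>2 * k + 1\<close> makes the induction close, since \<open>(2 * k + 1) * (2 * k + 3) \<le> 4 * (k + 1) ^ 2\<close>.\<close>
lemma central_binomial_even_upper_bound: "((2 * k) choose k) ^ 2 * (2 * k + 1) \<le> 16 ^ k"
proof (induction k)
  case 0
  then show ?case by simp
next
  case (Suc k)
  let ?b = "(2 * k) choose k" and ?c = "(2 * k + 2) choose (k + 1)"
  have "(k + 1) ^ 2 * (?c ^ 2 * (2 * k + 3)) = ((k + 1) * ?c) ^ 2 * (2 * k + 3)"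
    by (simp only: power_mult_distrib mult.assoc)
  also have "\<dots> = (?b ^ 2 * (2 * k + 1)) * (4 * ((2 * k + 1) * (2 * k + 3)))"
    unfolding central_binomial_Suc by (simp add: power2_eq_square algebra_simps)
  also have "\<dots> \<le> 16 ^ k * (16 * (k + 1) ^ 2)"
    by (rule mult_le_mono[OF Suc.IH]) (simp add: power2_eq_square algebra_simps)
  also have "\<dots> = (k + 1) ^ 2 * 16 ^ Suc k" by simp
  finally have "?c ^ 2 * (2 * k + 3) \<le> 16 ^ Suc k" by (simp only: mult_le_cancel1) simp
  then show ?case by (simp add: eval_nat_numeral)
qed

lemma central_binomial_upper_bound: "(m choose (m div 2)) ^ 2 * m \<le> 4 ^ m"
proof (cases "even m")
  case True
  then obtain k where m: "m = 2 * k" by blast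
  have "(m choose (m div 2)) ^ 2 * m \<le> ((2 * k) choose k) ^ 2 * (2 * k + 1)"
    unfolding m by (intro mult_le_mono) auto
  also have "\<dots> \<le> 4 ^ m" using central_binomial_even_upper_bound[of k] by (simp add: m power_mult)
  finally show ?thesis .
next
  case False
  then obtain k where m: "m = 2 * k + 1" by (rule oddE)
  have "(m choose (m div 2)) \<le> 2 * ((2 * k) choose k)"
  proof (cases k)
    case (Suc j)
    have "m choose (m div 2) = ((2 * k) choose j) + ((2 * k) choose k)"
      unfolding m Suc by simp
    then show ?thesis using binomial_maximum'[of k j] by simp
  qed (simp add: m)
  then have "(m choose (m div 2)) ^ 2 * m \<le> (2 * ((2 * k) choose k)) ^ 2 * (2 * k + 1)"
    unfolding m by (intro mult_le_mono power_mono) auto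
  also have "\<dots> = 4 * (((2 * k) choose k) ^ 2 * (2 * k + 1))" by (simp add: power_mult_distrib)
  also have "\<dots> \<le> 4 ^ m" using central_binomial_even_upper_bound[of k] by (simp add: m power_mult)
  finally show ?thesis .
qed

lemma central_binomial_le_two_power_div_sqrt:
  assumes "m \<ge> 1"
  shows "real (m choose (m div 2)) \<le> 2 ^ Suc m / sqrt (real (Suc m))"
proof -
  let ?b = "m choose (m div 2)"
  have "?b ^ 2 * Suc m \<le> ?b ^ 2 * (2 * m)" using assms by (intro mult_le_mono2) simp
  also have "\<dots> = 2 * (?b ^ 2 * m)" by simp
  also have "\<dots> \<le> 2 * 4 ^ m" using central_binomial_upper_bound by simp
  also have "\<dots> \<le> 4 ^ Suc m" by simp
  finally have "real (?b ^ 2 * Suc m) \<le> real (4 ^ Suc m)" by (rule of_nat_mono)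
  moreover have "(4::real) ^ Suc m = (2 ^ Suc m) ^ 2"
    using power_mult[of "2::real" 2 "Suc m"] power_mult[of "2::real" "Suc m" 2] by (simp add: mult.commute)
  ultimately have "(real ?b * sqrt (real (Suc m))) ^ 2 \<le> (2 ^ Suc m) ^ 2"
    by (simp add: power_mult_distrib distrib_left)
  then have "real ?b * sqrt (real (Suc m)) \<le> 2 ^ Suc m" by (rule power2_le_imp_le) simp
  then show ?thesis by (simp add: pos_le_divide_eq)
qed

text \<open>The variance of the size of a random subset; each new ground element turns the deviation \<open>x\<close> into
  \<open>x - 1\<close> and \<open>x + 1\<close>.\<close>
lemma sum_square_deviation: "(\<Sum>S\<in>Pow {1..n}. (2 * real (card S) - real n) ^ 2) = real n * 2 ^ n"
proof (induction n)
  case 0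
  then show ?case by simp
next
  case (Suc n)
  let ?A = "Pow {1..n}" and ?f = "\<lambda>S. (2 * real (card S) - real (Suc n)) ^ 2"
  have ins: "{1..Suc n} = insert (Suc n) {1..n}" by auto
  have inj: "inj_on (insert (Suc n)) ?A" 
  proof (rule inj_onI)
    fix S T assume "S \<in> ?A" "T \<in> ?A" "insert (Suc n) S = insert (Suc n) T"
    moreover from this have "Suc n \<notin> S" "Suc n \<notin> T" by auto
    ultimately show "S = T" using insert_ident by metis
  qed
  have "sum ?f (Pow {1..Suc n}) = sum ?f ?A + sum ?f (insert (Suc n) ` ?A)"
    unfolding ins Pow_insert by (rule sum.union_disjoint) auto
  also have "\<dots> = (\<Sum>S\<in>?A. ?f S + ?f (insert (Suc n) S))"
    by (subst sum.reindex[OF inj]) (simp add: sum.distrib)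
  also have "\<dots> = (\<Sum>S\<in>?A. 2 * (2 * real (card S) - real n) ^ 2 + 2)"
  proof (rule sum.cong)
    fix S assume "S \<in> ?A"
    then have "finite S" "Suc n \<notin> S" using finite_subset by auto
    then show "?f S + ?f (insert (Suc n) S) = 2 * (2 * real (card S) - real n) ^ 2 + 2"
      by (simp add: power2_eq_square algebra_simps)
  qed simp
  also have "\<dots> = 2 * (real n * 2 ^ n) + 2 * 2 ^ n"
    by (simp only: sum.distrib sum_distrib_left[symmetric] Suc.IH) (simp add: card_Pow)
  finally show ?case by (simp add: algebra_simps)
qed

text \<open>Chebyshev's inequality: a set outside the middle layers contributes at least \<open>n powr (4 / 3)\<close> to the sum
  \<open>n * 2 ^ n\<close> of the squared deviations.\<close>
lemma card_outside_middle_le: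
  assumes "n \<ge> 1"
  shows "real (card (Pow {1..n} - middle n)) \<le> 2 ^ n * real n powr (- 1 / 3)"
proof -
  let ?O = "Pow {1..n} - middle n"
  have sq: "real n powr (4 / 3) = (real n powr (2 / 3)) ^ 2"
    by (simp add: power2_eq_square flip: powr_add)
  have "real (card ?O) * real n powr (4 / 3) = (\<Sum>S\<in>?O. real n powr (4 / 3))" by simp
  also have "\<dots> \<le> (\<Sum>S\<in>?O. (2 * real (card S) - real n) ^ 2)"
  proof (rule sum_mono)
    fix S assume "S \<in> ?O"
    then have "real n powr (2 / 3) \<le> \<bar>2 * real (card S) - real n\<bar>" by (auto simp: middle_def)
    then have "(real n powr (2 / 3)) ^ 2 \<le> \<bar>2 * real (card S) - real n\<bar> ^ 2" by (intro power_mono) auto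
    then show "real n powr (4 / 3) \<le> (2 * real (card S) - real n) ^ 2" unfolding sq by simp
  qed
  also have "\<dots> \<le> (\<Sum>S\<in>Pow {1..n}. (2 * real (card S) - real n) ^ 2)" by (intro sum_mono2) auto
  also have "\<dots> = real n * 2 ^ n" by (rule sum_square_deviation)
  also have "\<dots> = (2 ^ n * real n powr (- 1 / 3)) * real n powr (4 / 3)"
    using assms by (simp add: mult.assoc flip: powr_add)
  finally show ?thesis using assms by (simp only: mult_le_cancel_right) (simp split: if_splits)
qed

lemma middle_nonempty:
  assumes "n \<ge> 1"
  shows "middle n \<noteq> {}"
proof -
  have "1 \<le> real n powr (2 / 3)" using assms by (intro ge_one_powr_ge_zero) auto
  moreover have "\<bar>real (n div 2) - real n / 2\<bar> \<le> 1" by linarith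
  ultimately have "{1..n div 2} \<in> middle n" unfolding middle_def by auto
  then show ?thesis by blast
qed

text \<open>Colour classes inside the middle layers give the lower bound; the window colouring, with its own
  colour for each set outside the middle layers, gives the upper bound. Since the
  independence number is at most \<open>2 * card P\<close>, the error terms remain negligible after multiplication with it.\<close>
lemma ar_star_m_times_independence_number:
  assumes P: "finite_poset P r" "\<not> poset_chain P r" "\<not> poset_antichain P r"
    and n: "n \<ge> 8000" "n \<ge> 40 * 2 ^ card P"
  defines "\<alpha> \<equiv> real (independence_number (induced (copy_graph P r n) (middle n)))"
    and "D \<equiv> real (card P)"
  shows "\<bar>1 - real (ar_star_m n (2 ^ n) P r) * \<alpha> / 2 ^ n\<bar> \<le>
      2 * D * (4 * D + 4) * (1 / sqrt (real n)) + (2 * D + 1) * real n powr (- 1 / 3)"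
    and "0 < \<alpha>"
proof -
  let ?ar = "real (ar_star_m n (2 ^ n) P r)"
  obtain m where m: "n = Suc m" "m \<ge> 1" using n(1) by (cases n) auto
  have M: "middle n \<noteq> {}" using n(1) by (intro middle_nonempty) simp
  obtain c1 c2 d where w: "window_shape P r n c1 c2 d" "0 < c1 + c2" "c1 \<le> card P" "c2 \<le> card P"
    "\<bar>d\<bar> \<le> int (card P)" "\<alpha> \<le> real (c1 + c2)"
    using exists_window_shape[OF P n M] unfolding \<alpha>_def by auto
  define out where "out = real (card (Pow {1..n} - middle n))"
  have out: "out \<le> 2 ^ n * real n powr (- 1 / 3)" "0 \<le> out"
    unfolding out_def using card_outside_middle_le[of n] n(1) by auto
  have "card (Pow {1..n} - middle n) = 2 ^ n - card (middle n)" "card (middle n) \<le> 2 ^ n"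
    using card_Diff_subset[of "middle n" "Pow {1..n}"] finite_middle[of n] middle_subset[of _ n]
      card_mono[of "Pow {1..n}" "middle n"] by (auto simp: card_Pow)
  then have mid: "real (card (middle n)) = 2 ^ n - out" unfolding out_def by (simp add: of_nat_diff)
  have "card (middle n) \<le> ar_star_m n (2 ^ n) P r * independence_number (induced (copy_graph P r n) (middle n))"
    by (rule card_middle_le_ar_star_m[OF P(1)])
  then have "real (card (middle n)) \<le> real (ar_star_m n (2 ^ n) P r * independence_number (induced (copy_graph P r n) (middle n)))"
    by (rule of_nat_mono)
  then have low: "real (card (middle n)) \<le> ?ar * \<alpha>" unfolding \<alpha>_def by simp
  have "0 < real (card (middle n))" using M finite_middle[of n] by (simp add: card_gt_0_iff)
  with low show pos: "0 < \<alpha>" unfolding \<alpha>_def by (cases "independence_number (induced (copy_graph P r n) (middle n)) = 0") auto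
  have "ar_star_m n (2 ^ n) P r \<le> card (window_colour m c1 c2 d ` Pow {1..n})"
    unfolding m(1)
    by (rule ar_star_m_le_card_colours[OF P(1)])
      (rule window_colour_proper[OF P(1) w(1)[unfolded m(1)] w(2)])
  then have "?ar \<le> real (card (window_colour m c1 c2 d ` Pow {1..n}))" by simp
  also have "\<dots> \<le> 2 ^ n / real (c1 + c2) + (4 * D + 4) * real (m choose (m div 2)) + out"
    using card_window_colours_le[OF w(2,5), of m] unfolding m(1) out_def D_def .
  also have "\<dots> \<le> 2 ^ n / real (c1 + c2) + (4 * D + 4) * (2 ^ n / sqrt (real n)) + out"
    using central_binomial_le_two_power_div_sqrt[OF m(2)] unfolding m(1)
    by (intro add_mono mult_left_mono) (auto simp: D_def)
  finally have up: "?ar \<le> 2 ^ n / real (c1 + c2) + (4 * D + 4) * (2 ^ n / sqrt (real n)) + out" .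
  have \<alpha>D: "\<alpha> \<le> 2 * D" using w(3,4,6) unfolding D_def by linarith
  have "?ar * \<alpha> \<le> (2 ^ n / real (c1 + c2) + ((4 * D + 4) * (2 ^ n / sqrt (real n)) + out)) * \<alpha>"
    using up pos by (intro mult_right_mono) auto
  also have "\<dots> = 2 ^ n / real (c1 + c2) * \<alpha> + ((4 * D + 4) * (2 ^ n / sqrt (real n)) + out) * \<alpha>"
    by (rule distrib_right)
  also have "\<dots> \<le> 2 ^ n + ((4 * D + 4) * (2 ^ n / sqrt (real n)) + out) * (2 * D)"
  proof (intro add_mono mult_left_mono \<alpha>D)
    show "2 ^ n / real (c1 + c2) * \<alpha> \<le> 2 ^ n"
    proof -
      have "0 < real (c1 + c2)" using w(2) by (simp only: of_nat_0_less_iff)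
      then have "\<alpha> / real (c1 + c2) \<le> 1" using w(6) by (simp only: pos_divide_le_eq mult_1)
      then have "2 ^ n * (\<alpha> / real (c1 + c2)) \<le> 2 ^ n" by (intro mult_left_le) auto
      then show ?thesis by (simp add: mult.commute)
    qed
    show "0 \<le> (4 * D + 4) * (2 ^ n / sqrt (real n)) + out" using out(2) unfolding D_def by simp
  qed
  finally have hi: "?ar * \<alpha> \<le> 2 ^ n + ((4 * D + 4) * (2 ^ n / sqrt (real n)) + out) * (2 * D)" .
  define s q where "s = 1 / sqrt (real n)" and "q = real n powr (- 1 / 3)"
  have sq: "0 \<le> s" "0 \<le> q" "0 \<le> D" unfolding s_def q_def D_def by auto
  have "?ar * \<alpha> \<le> 2 ^ n + ((4 * D + 4) * (2 ^ n * s) + 2 ^ n * q) * (2 * D)"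
  proof -
    have "((4 * D + 4) * (2 ^ n / sqrt (real n)) + out) * (2 * D)
        \<le> ((4 * D + 4) * (2 ^ n * s) + 2 ^ n * q) * (2 * D)"
      using out(1) sq(3) unfolding s_def q_def by (intro mult_right_mono add_mono) auto
    then show ?thesis using hi by linarith
  qed
  also have "\<dots> = 2 ^ n * (1 + (2 * D * (4 * D + 4) * s + 2 * D * q))" by (simp add: algebra_simps)
  finally have "?ar * \<alpha> / 2 ^ n \<le> 1 + (2 * D * (4 * D + 4) * s + 2 * D * q)"
    by (simp add: pos_divide_le_eq mult.commute)
  moreover have "2 ^ n * (1 - q) \<le> ?ar * \<alpha>"
    using low mid out(1) unfolding q_def by (simp add: algebra_simps)
  then have "1 - q \<le> ?ar * \<alpha> / 2 ^ n" by (simp add: pos_le_divide_eq mult.commute)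
  moreover have "0 \<le> 2 * D * (4 * D + 4) * s" "0 \<le> 2 * D * q" "0 \<le> q" using sq by auto
  ultimately have "\<bar>1 - ?ar * \<alpha> / 2 ^ n\<bar> \<le> 2 * D * (4 * D + 4) * s + (2 * D + 1) * q"
    by (simp add: abs_le_iff algebra_simps)
  then show "\<bar>1 - ?ar * \<alpha> / 2 ^ n\<bar> \<le>
      2 * D * (4 * D + 4) * (1 / sqrt (real n)) + (2 * D + 1) * real n powr (- 1 / 3)"
    unfolding s_def q_def .
qed

lemma ar_star_m_asymptotic:
  assumes P: "finite_poset P r" "\<not> poset_chain P r" "\<not> poset_antichain P r"
  shows "\<exists>\<epsilon> :: nat \<Rightarrow> real. \<epsilon> \<in> o(\<lambda>_. 1) \<and>
    (\<forall>\<^sub>F n in sequentially. real (ar_star_m n (2 ^ n) P r) =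
       (1 - \<epsilon> n) * 2 ^ n / real (independence_number (induced (copy_graph P r n) (middle n))))"
proof -
  define \<alpha> where "\<alpha> n = real (independence_number (induced (copy_graph P r n) (middle n)))" for n
  define \<epsilon> where "\<epsilon> n = 1 - real (ar_star_m n (2 ^ n) P r) * \<alpha> n / 2 ^ n" for n
  define D where "D = real (card P)"
  define g where "g n = 2 * D * (4 * D + 4) * (1 / sqrt (real n)) + (2 * D + 1) * real n powr (- 1 / 3)" for n
  have large: "\<forall>\<^sub>F n in sequentially. n \<ge> 8000 \<and> n \<ge> 40 * 2 ^ card P"
    by (intro eventually_conj eventually_ge_at_top)
  have "(\<lambda>n. 1 / sqrt (real n)) \<longlonglongrightarrow> 0"
    by (intro tendsto_divide_0[OF tendsto_const] filterlim_at_top_imp_at_infinity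
        filterlim_compose[OF sqrt_at_top] filterlim_real_sequentially)
  moreover have "(\<lambda>n. real n powr (- 1 / 3)) \<longlonglongrightarrow> 0"
    by (rule tendsto_neg_powr[OF _ filterlim_real_sequentially]) simp
  ultimately have "g \<longlonglongrightarrow> 2 * D * (4 * D + 4) * 0 + (2 * D + 1) * 0"
    unfolding g_def by (intro tendsto_intros)
  then have g: "g \<longlonglongrightarrow> 0" by simp
  have "\<forall>\<^sub>F n in sequentially. norm (\<epsilon> n) \<le> norm (g n) * 1"
    using large
  proof eventually_elim
    case (elim n)
    then show ?case
      using ar_star_m_times_independence_number(1)[OF P, of n] unfolding \<epsilon>_def \<alpha>_def g_def D_def by simp
  qed
  then have "\<epsilon> \<longlonglongrightarrow> 0" using g tendsto_0_le by blast
  then have "\<epsilon> \<in> o(\<lambda>_. 1)" by (intro smalloI_tendsto) auto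
  moreover have "\<forall>\<^sub>F n in sequentially. real (ar_star_m n (2 ^ n) P r) = (1 - \<epsilon> n) * 2 ^ n / \<alpha> n"
    using large
  proof eventually_elim
    case (elim n)
    then have "0 < \<alpha> n" using ar_star_m_times_independence_number(2)[OF P, of n] unfolding \<alpha>_def by simp
    then show ?case unfolding \<epsilon>_def by simp
  qed
  ultimately show ?thesis unfolding \<alpha>_def by blast
qed

theorem theorem1p6:
  shows "(\<forall>(P :: 'a set) r. finite_poset P r \<and> \<not> poset_chain P r \<and> \<not> poset_antichain P r \<longrightarrow>
            (\<exists>\<epsilon> :: nat \<Rightarrow> real. \<epsilon> \<in> o(\<lambda>_. 1) \<and>
               (\<forall>\<^sub>F n in sequentially.
                  real (ar_star_m n (2 ^ n) P r) =
                    (1 - \<epsilon> n) * 2 ^ n / real (independence_number (induced (copy_graph P r n) (middle n))))))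
       \<and> (\<forall>t :: nat. t > 0 \<longrightarrow>
            (\<exists>(P :: nat set) r. finite_poset P r \<and> \<not> poset_chain P r \<and> \<not> poset_antichain P r \<and>
               (\<forall>\<^sub>F n in sequentially.
                  independence_number (induced (copy_graph P r n) (middle n)) = t)))"
proof (intro conjI allI impI)
  fix P :: "'a set" and r
  assume "finite_poset P r \<and> \<not> poset_chain P r \<and> \<not> poset_antichain P r"
  then show "\<exists>\<epsilon> :: nat \<Rightarrow> real. \<epsilon> \<in> o(\<lambda>_. 1) \<and>
      (\<forall>\<^sub>F n in sequentially. real (ar_star_m n (2 ^ n) P r) =
        (1 - \<epsilon> n) * 2 ^ n / real (independence_number (induced (copy_graph P r n) (middle n))))"
    by (intro ar_star_m_asymptotic) simp_all
next
  fix t :: nat assume t: "t > 0"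
  let ?P = "{..<2 * (t + 2)}" and ?r = "standard_example (t + 2)"
  have "\<forall>\<^sub>F n in sequentially. n \<ge> 8000 \<and> n \<ge> (t + 2) ^ 3"
    by (intro eventually_conj eventually_ge_at_top)
  then have "\<forall>\<^sub>F n in sequentially. independence_number (induced (copy_graph ?P ?r n) (middle n)) = t"
    by eventually_elim (simp only: independence_number_standard_example[OF t])
  then show "\<exists>(P :: nat set) r. finite_poset P r \<and> \<not> poset_chain P r \<and> \<not> poset_antichain P r \<and>
      (\<forall>\<^sub>F n in sequentially. independence_number (induced (copy_graph P r n) (middle n)) = t)"
    using finite_poset_standard_example[of "t + 2"] standard_example_not_chain[of "t + 2"]
      standard_example_not_antichain[of "t + 2"]
    by (intro exI[of _ ?P] exI[of _ ?r] conjI) simp_all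
qed

end
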